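(* Let $c\colon\mathbb{R}\times\mathbb{R}\to\mathbb{R}$ be a lower semicontinuous cost function, bounded from below, satisfying the Monge condition, the integer shift invariance condition and the growth condition (see context), and let $\mu_0,\mu_1$ be periodic positive measures on $\mathbb{R}$ with unit mass in each period and distribution functions $F_0,F_1$. Then the average cost $C_{[F_0,F_1]}$ is a convex function that satisfies, for all $\theta\in\mathbb{R}$, $$\inf_{x,y}c(x,y)\le\underline C(\theta)\le C_{[F_0,F_1]}(\theta)\le\overline C(\theta),$$ where $$\underline C(\theta)=\inf_{\substack{-1\le u_1\le 2\\ \theta-1\le u_2\le\theta+2}}c(u_1,u_2),\qquad \overline C(\theta)=\sup_{\substack{-1\le u_1\le 2\\ \theta-1\le u_2\le\theta+2}}c(u_1,u_2).$$ Moreover, there exist constants $\underline\Theta<\overline\Theta$ and $\underline L,\overline L>0$ such that the global minimum of $C_{[F_0,F_1]}$ is achieved on the interval $[\underline\Theta,\overline\Theta]$ and $$-\underline L\le C_{[F_0,F_1]}'(\underline\Theta-0)\le 0\le C_{[F_0,F_1]}'(\overline\Theta+0)\le\overline L,$$ where $C_{[F_0,F_1]}'$ is the derivative of $C_{[F_0,F_1]}$. These constants are independent of $\mu_0,\mu_1$ and are given explicitly by $$\underline\Theta=\inf\{\theta\colon\underline C(\theta)=\min_{\theta'}\overline C(\theta')\},\qquad \overline\Theta=\sup\{\theta\colon\underline C(\theta)=\min_{\theta'}\overline C(\theta')\},$$ $$\overline L=\inf_{\theta>\overline\Theta}\frac{\overline C(\theta)-\underline C(\overline\Theta)}{\theta-\overline\Theta},\qquad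 \underline L=\inf_{\theta<\underline\Theta}\frac{\overline C(\theta)-\underline C(\underline\Theta)}{\underline\Theta-\theta}.$$
   Context: Conditions on $c$: Monge condition: $c(x_1,y_1)+c(x_2,y_2)<c(x_1,y_2)+c(x_2,y_1)$ whenever $x_1<x_2$, $y_1<y_2$. Integer shift invariance: $c(x+1,y+1)=c(x,y)$ for all $x,y$. Growth: for any $P$ there is a finite $R(P)\ge0$ such that $c(x,y)\ge P$ whenever $|x-y|\ge R(P)$. A measure $\mu$ on $\mathbb{R}$ is periodic if $\mu(A+n)=\mu(A)$ for every integer $n$ and Borel $A$; unit mass in each period means $\mu((x,x+1])=1$ for all $x$. Distribution function: $F_\mu(0)=0$, $F_\mu(x)=\mu((0,x])$ for $x>0$, $F_\mu(x)=-\mu((x,0])$ for $x<0$; $F_i=F_{\mu_i}$. For a nondecreasing function $F$ of this type (also shifted by a constant), $F^{-1}(y)=\inf\{x\colon y<F(x)\}$. Put $c_{[F_0,F_1]}(v_0,v_1)=c(F_0^{-1}(v_0),F_1^{-1}(v_1))$ and $F_1^\theta(u)=F_1(u)-\theta$, so $(F_1^\theta)^{-1}(v)=F_1^{-1}(v+\theta)$. The average cost (per period) is $$C_{[F_0,F_1]}(\theta)=\int_0^1c_{[F_0,F_1]}(v',v'+\theta)\,dv'=\int_0^1c\bigl(F_0^{-1}(v'),(F_1^\theta)^{-1}(v')\bigr)\,dv'.$$ $C'(\theta\pm0)$ denote the right and left derivatives of the convex function $C$.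
   Formalization: The "Moreover" part fails for merely lower semicontinuous c; it is proved for continuous c with the sets as written, and for lower semicontinuous c with the minimum of the upper bound finite and "=" replaced by "≤" in the sets defining the two Theta constants. *)

theory Defs
  imports "HOL-Analysis.Analysis"
begin

definition lower_semicontinuous :: "('a::topological_space \<Rightarrow> real) \<Rightarrow> bool" where
  "lower_semicontinuous f \<longleftrightarrow> (\<forall>a. open {x. a < f x})"

definition monge :: "(real \<Rightarrow> real \<Rightarrow> real) \<Rightarrow> bool" where
  "monge c \<longleftrightarrow>
     (\<forall>x1 x2 y1 y2. x1 < x2 \<longrightarrow> y1 < y2 \<longrightarrow> c x1 y1 + c x2 y2 < c x1 y2 + c x2 y1)"

definition integer_shift_invariant :: "(real \<Rightarrow> real \<Rightarrow> real) \<Rightarrow> bool" where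
  "integer_shift_invariant c \<longleftrightarrow> (\<forall>x y. c (x + 1) (y + 1) = c x y)"

definition growth_condition :: "(real \<Rightarrow> real \<Rightarrow> real) \<Rightarrow> bool" where
  "growth_condition c \<longleftrightarrow> (\<forall>P. \<exists>R\<ge>0. \<forall>x y. R \<le> \<bar>x - y\<bar> \<longrightarrow> P \<le> c x y)"

definition periodic_measure :: "real measure \<Rightarrow> bool" where
  "periodic_measure \<mu> \<longleftrightarrow> sets \<mu> = sets borel \<and>
     (\<forall>A\<in>sets borel. \<forall>n::int. emeasure \<mu> ((\<lambda>x. x + of_int n) ` A) = emeasure \<mu> A)"

definition unit_mass_per_period :: "real measure \<Rightarrow> bool" where
  "unit_mass_per_period \<mu> \<longleftrightarrow> (\<forall>x. emeasure \<mu> {x<..x + 1} = 1)"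

definition distr_fun :: "real measure \<Rightarrow> real \<Rightarrow> real" where
  "distr_fun \<mu> x =
     (if 0 < x then measure \<mu> {0<..x} else if x < 0 then - measure \<mu> {x<..0} else 0)"

definition gen_inverse :: "(real \<Rightarrow> real) \<Rightarrow> real \<Rightarrow> real" where
  "gen_inverse F y = Inf {x. y < F x}"

definition transported_cost ::
  "(real \<Rightarrow> real \<Rightarrow> real) \<Rightarrow> (real \<Rightarrow> real) \<Rightarrow> (real \<Rightarrow> real) \<Rightarrow> real \<Rightarrow> real \<Rightarrow> real" where
  "transported_cost c F0 F1 v0 v1 = c (gen_inverse F0 v0) (gen_inverse F1 v1)"

text \<open>The Lebesgue integral of a function whose negative part is integrable, with value
  \<open>\<infinity>\<close> when the positive part is not. The Bochner integral would return 0 in that case,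
  and a lower semicontinuous cost that is bounded from below can be unbounded above on compact
  sets, so that its average cost is infinite.\<close>

definition ext_integral :: "'a measure \<Rightarrow> ('a \<Rightarrow> real) \<Rightarrow> ereal" where
  "ext_integral M f =
     enn2ereal (\<integral>\<^sup>+x. ennreal (f x) \<partial>M) - enn2ereal (\<integral>\<^sup>+x. ennreal (- f x) \<partial>M)"

definition avg_cost ::
  "(real \<Rightarrow> real \<Rightarrow> real) \<Rightarrow> (real \<Rightarrow> real) \<Rightarrow> (real \<Rightarrow> real) \<Rightarrow> real \<Rightarrow> ereal" where
  "avg_cost c F0 F1 \<theta> =
     ext_integral (restrict_space lborel {0..1}) (\<lambda>v. transported_cost c F0 F1 v (v + \<theta>))"

definition ext_convex :: "(real \<Rightarrow> ereal) \<Rightarrow> bool" where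
  "ext_convex f \<longleftrightarrow> (\<forall>x y t. 0 \<le> t \<longrightarrow> t \<le> 1 \<longrightarrow>
     f ((1 - t) * x + t * y) \<le> ereal (1 - t) * f x + ereal t * f y)"

definition lower_cost :: "(real \<Rightarrow> real \<Rightarrow> real) \<Rightarrow> real \<Rightarrow> real" where
  "lower_cost c \<theta> = (INF (u1, u2) \<in> {-1..2} \<times> {\<theta> - 1..\<theta> + 2}. c u1 u2)"

text \<open>Extended-real-valued, because the supremum of a lower semicontinuous function over a
  compact set may be infinite.\<close>

definition upper_cost :: "(real \<Rightarrow> real \<Rightarrow> real) \<Rightarrow> real \<Rightarrow> ereal" where
  "upper_cost c \<theta> = (SUP (u1, u2) \<in> {-1..2} \<times> {\<theta> - 1..\<theta> + 2}. ereal (c u1 u2))"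

definition min_upper_cost :: "(real \<Rightarrow> real \<Rightarrow> real) \<Rightarrow> ereal" where
  "min_upper_cost c = (INF \<theta>. upper_cost c \<theta>)"

text \<open>\<open>\<Theta>\<close> is the left end of the interval in \<open>left_slope_bound\<close> and its right end in
  \<open>right_slope_bound\<close>.\<close>

definition left_slope_bound :: "(real \<Rightarrow> real \<Rightarrow> real) \<Rightarrow> real \<Rightarrow> ereal" where
  "left_slope_bound c \<Theta> =
     (INF \<theta> \<in> {..<\<Theta>}. (upper_cost c \<theta> - ereal (lower_cost c \<Theta>)) / ereal (\<Theta> - \<theta>))"

definition right_slope_bound :: "(real \<Rightarrow> real \<Rightarrow> real) \<Rightarrow> real \<Rightarrow> ereal" where
  "right_slope_bound c \<Theta> =
     (INF \<theta> \<in> {\<Theta><..}. (upper_cost c \<theta> - ereal (lower_cost c \<Theta>)) / ereal (\<theta> - \<Theta>))"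

end

theory Submission
  imports Defs
begin

text \<open>
  Let \<open>G\<^sub>0\<close>, \<open>G\<^sub>1\<close> be the inverses of the two distribution functions. Unit mass per period makes
  them nondecreasing, commuting with the shift by \<open>1\<close>, and within distance \<open>1\<close> of the identity.
  Hence \<open>h v w = c (G\<^sub>0 v) (G\<^sub>1 w)\<close> satisfies the non-strict Monge inequality and is invariant under
  the diagonal shift by \<open>1\<close>, and for \<open>v \<in> [0,1]\<close> the value \<open>h v (v + \<theta>)\<close> is a value of \<open>c\<close> in the
  window \<open>[-1,2] \<times> [\<theta>-1,\<theta>+2]\<close>. The latter gives the bounds of the average cost \<open>C\<close> by the lower and
  upper costs.

  Convexity: the Monge inequality at the points \<open>v \<le> v + d\<close> and \<open>v + m \<le> v + m + d\<close>, integrated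
  over a period, reads \<open>2 C(m) \<le> C(m + d) + C(m - d)\<close>, because the integral of a periodic function
  over a period does not change under translation (\<open>shifted_avg_midpoint\<close>). By Fatou's lemma \<open>C\<close> is
  lower semicontinuous (\<open>shifted_avg_lsc\<close>), and midpoint convexity together with lower semicontinuity
  gives convexity, also where \<open>C\<close> is infinite (\<open>ext_convex_if_midpoint\<close>).

  Endpoints: let \<open>m\<close> be the minimum of the upper cost, assumed finite and attained at \<open>a\<close>. Since windows of parameters
  at distance at most \<open>1\<close> overlap, and a strictly Monge cost is not constant on the overlap, the
  lower cost at \<open>\<theta>\<close> is strictly below the upper cost at every \<open>\<theta>'\<close> with \<open>|\<theta>' - \<theta>| \<le> 1\<close>
  (\<open>lower_upper_gap\<close>). So the sublevel set of the lower cost at height \<open>m\<close>, which is compact,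
  contains \<open>a - 1\<close> and \<open>a + 1\<close>; outside of it \<open>C > m \<ge> C(a)\<close>, which places the minimum of \<open>C\<close> and
  gives the signs of the one-sided derivatives. These derivatives are bounded by the slopes of the
  chords to the upper cost. That the infimum of these slopes is positive follows from the gap near
  the endpoint and from convexity of \<open>C\<close> far from it (\<open>convex_right_end\<close>); it is finite because the
  upper cost is finite everywhere as soon as it is finite somewhere (\<open>upper_cost_finite\<close>).
\<close>

section \<open>Semicontinuity and convexity on the line\<close>

lemma lsc_attains_inf:
  fixes f :: "'a::topological_space \<Rightarrow> 'b::linorder"
  assumes K: "compact K" "K \<noteq> {}" and lsc: "\<And>a. open {x. a < f x}"
  shows "\<exists>x\<in>K. \<forall>y\<in>K. f x \<le> f y"
proof (rule ccontr)
  assume "\<not> ?thesis"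
  then have "K \<subseteq> (\<Union>y\<in>K. {x. f y < f x})"
    by (auto simp: not_le)
  then obtain D where D: "D \<subseteq> K" "finite D" "K \<subseteq> (\<Union>y\<in>D. {x. f y < f x})"
    using compactE_image[OF K(1), of K "\<lambda>y. {x. f y < f x}"] lsc by metis
  then have "D \<noteq> {}" using K(2) by auto
  then obtain y where y: "y \<in> D" "\<And>z. z \<in> D \<Longrightarrow> f y \<le> f z"
    using D(2) by (metis ex_is_arg_min_if_finite is_arg_min_linorder)
  with D show False by fastforce
qed

lemma midpoint_closed_Icc:
  fixes D :: "real set"
  assumes "closed D" and "0 \<in> D" "1 \<in> D"
    and mid: "\<And>s t. s \<in> D \<Longrightarrow> t \<in> D \<Longrightarrow> (s + t) / 2 \<in> D"
  shows "{0..1} \<subseteq> D"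
proof (rule subsetI, rule ccontr)
  fix t :: real
  assume t: "t \<in> {0..1}" "t \<notin> D"
  \<comment> \<open>The gap of \<open>D\<close> around \<open>t\<close> has its endpoints in \<open>D\<close>, hence also its midpoint.\<close>
  define a b where "a = Sup (D \<inter> {0..t})" and "b = Inf (D \<inter> {t..1})"
  have "a \<in> D \<inter> {0..t}" unfolding a_def
    using assms t by (intro closed_contains_Sup) auto
  moreover have "b \<in> D \<inter> {t..1}" unfolding b_def
    using assms t by (intro closed_contains_Inf) auto
  ultimately have ab: "a \<in> D" "b \<in> D" "0 \<le> a" "a < t" "t < b" "b \<le> 1"
    using t by (auto simp: less_le)
  then have m: "(a + b) / 2 \<in> D" using mid by blast
  show False
  proof (cases "(a + b) / 2 \<le> t")
    case True
    then have "(a + b) / 2 \<le> a"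
      using m ab by (subst (2) a_def, intro cSup_upper) auto
    with ab show False by simp
  next
    case False
    then have "b \<le> (a + b) / 2"
      using m ab by (subst b_def, intro cInf_lower) auto
    with ab show False by simp
  qed
qed

text \<open>The set of parameters at which the chord inequality holds is closed, by lower
  semicontinuity, and contains the midpoint of any two of its points.\<close>

lemma ext_convex_if_midpoint:
  fixes f :: "real \<Rightarrow> ereal"
  assumes lsc: "\<And>a. open {x. a < f x}"
    and ninf: "\<And>x. f x \<noteq> -\<infinity>"
    and mid: "\<And>m d. f m + f m \<le> f (m + d) + f (m - d)"
  shows "ext_convex f"
  unfolding ext_convex_def
proof (intro allI impI)
  fix x y t :: real
  assume t: "0 \<le> t" "t \<le> 1"
  show "f ((1 - t) * x + t * y) \<le> ereal (1 - t) * f x + ereal t * f y"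
  proof (cases "t = 0 \<or> t = 1 \<or> f x = \<infinity> \<or> f y = \<infinity>")
    case True
    have "f ((1 - t) * x + t * y) \<le> ereal (1 - t) * f x + ereal t * f y"
      if "0 < t" "t < 1" "f x = \<infinity> \<or> f y = \<infinity>"
      using that ninf[of x] ninf[of y] by (cases "f x"; cases "f y") auto
    then show ?thesis using True t by (auto simp flip: zero_ereal_def one_ereal_def)
  next
    case False
    then obtain a b where ab: "f x = ereal a" "f y = ereal b"
      using ninf by (metis ereal_cases)
    define z where "z s = (1 - s) * x + s * y" for s
    define e where "e s = (1 - s) * a + s * b" for s
    define D where "D = {s. f (z s) \<le> ereal (e s)}"
    have "open {s. ereal (e s) < f (z s)}"
    proof -
      have eq: "{s. ereal (e s) < f (z s)} = (\<Union>r. {s. e s < r} \<inter> z -` {u. ereal r < f u})"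
      proof (intro set_eqI iffI)
        fix s assume "s \<in> {s. ereal (e s) < f (z s)}"
        then obtain r where "ereal (e s) < ereal r" "ereal r < f (z s)"
          using ereal_dense2[of "ereal (e s)" "f (z s)"] by auto
        then show "s \<in> (\<Union>r. {s. e s < r} \<inter> z -` {u. ereal r < f u})" by auto
      next
        fix s assume "s \<in> (\<Union>r. {s. e s < r} \<inter> z -` {u. ereal r < f u})"
        then obtain r where "ereal (e s) < ereal r" "ereal r < f (z s)" by auto
        then show "s \<in> {s. ereal (e s) < f (z s)}" by (blast intro: less_trans)
      qed
      have "open {s. e s < r}" for r
        unfolding e_def by (intro open_Collect_less continuous_intros)
      moreover have "open (z -` {u. ereal r < f u})" for r
        unfolding z_def by (intro open_vimage lsc continuous_intros)
      ultimately show ?thesis unfolding eq by blast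
    qed
    then have "closed D"
      unfolding D_def closed_def by (simp add: Collect_neg_eq[symmetric] not_le)
    moreover have "0 \<in> D" "1 \<in> D" by (auto simp: D_def z_def e_def ab)
    moreover have "(r + s) / 2 \<in> D" if rs: "r \<in> D" "s \<in> D" for r s
    proof -
      define m d where "m = (z r + z s) / 2" and "d = (z s - z r) / 2"
      have md: "m + d = z s" "m - d = z r" by (simp_all add: m_def d_def field_simps)
      have "f m + f m \<le> ereal (e s) + ereal (e r)"
        using order_trans[OF mid[of m d] add_mono] rs unfolding md D_def by blast
      then have "f m \<le> ereal ((e s + e r) / 2)"
        using ninf[of m] by (cases "f m") auto
      moreover have "m = z ((r + s) / 2)" "(e s + e r) / 2 = e ((r + s) / 2)"
        by (simp_all add: m_def z_def e_def field_simps)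
      ultimately show ?thesis by (simp add: D_def)
    qed
    ultimately have "t \<in> D" using midpoint_closed_Icc[of D] t by auto
    then show ?thesis by (simp add: D_def z_def e_def ab)
  qed
qed

section \<open>Distribution functions and their inverses\<close>

lemma emeasure_unit_mass_intervals:
  assumes "sets \<mu> = sets borel" "unit_mass_per_period \<mu>"
  shows "emeasure \<mu> {a<..a + real n} = of_nat n"
proof (induction n)
  case (Suc n)
  have "{a<..a + real (Suc n)} = {a<..a + real n} \<union> {a + real n<..a + real n + 1}"
    by auto
  also have "emeasure \<mu> \<dots> = emeasure \<mu> {a<..a + real n} + emeasure \<mu> {a + real n<..a + real n + 1}"
    using assms(1) by (intro plus_emeasure[symmetric]) auto
  also have "emeasure \<mu> {a + real n<..a + real n + 1} = 1"
    using assms(2) by (simp only: unit_mass_per_period_def)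
  finally show ?case using Suc by (simp add: add.commute)
qed simp

lemma distr_fun_diff:
  assumes "sets \<mu> = sets borel" "unit_mass_per_period \<mu>" "x \<le> y"
  shows "distr_fun \<mu> y - distr_fun \<mu> x = measure \<mu> {x<..y}"
proof -
  have fin: "emeasure \<mu> {a<..b} \<noteq> \<infinity>" for a b
  proof -
    have "emeasure \<mu> {a<..b} \<le> emeasure \<mu> {a<..a + real (nat \<lceil>b - a\<rceil>)}"
      using assms(1) by (intro emeasure_mono) (auto, linarith)
    then show ?thesis
      using emeasure_unit_mass_intervals[OF assms(1,2)]
      by (metis ennreal_of_nat_eq_real_of_nat ennreal_neq_top infinity_ennreal_def top.extremum_uniqueI)
  qed
  have add: "measure \<mu> {a<..d} = measure \<mu> {a<..b} + measure \<mu> {b<..d}"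
    if "a \<le> b" "b \<le> d" for a b d
    using that fin assms(1)
    by (subst measure_Union[symmetric]) (auto intro: arg_cong[where f = "measure \<mu>"])
  have pos: "distr_fun \<mu> x = measure \<mu> {0<..x}" if "0 \<le> x" for x
    using that by (simp add: distr_fun_def)
  have neg: "distr_fun \<mu> x = - measure \<mu> {x<..0}" if "x \<le> 0" for x
    using that by (simp add: distr_fun_def)
  consider "0 \<le> x" | "x \<le> 0" "0 \<le> y" | "y \<le> 0" by linarith
  then show ?thesis
    by cases (use assms(3) in \<open>simp_all add: pos neg add[of 0 x y] add[of x 0 y] add[of x y 0]\<close>)
qed

lemma
  assumes "sets \<mu> = sets borel" "unit_mass_per_period \<mu>"
  shows distr_fun_mono: "mono (distr_fun \<mu>)"
    and distr_fun_shift: "distr_fun \<mu> (x + 1) = distr_fun \<mu> x + 1"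
proof -
  show "mono (distr_fun \<mu>)"
    using distr_fun_diff[OF assms] by (metis diff_ge_0_iff_ge measure_nonneg monoI)
  have "measure \<mu> {x<..x + 1} = 1"
    using assms(2) by (simp add: unit_mass_per_period_def measure_def)
  then show "distr_fun \<mu> (x + 1) = distr_fun \<mu> x + 1"
    using distr_fun_diff[OF assms, of x "x + 1"] by simp
qed

lemma shift_equivariant_bounds:
  fixes F :: "real \<Rightarrow> real"
  assumes "mono F" and shift: "\<And>x. F (x + 1) = F x + 1" and "F 0 = 0"
  shows "x - 1 < F x" "F x < x + 1"
proof -
  have "F (real_of_int n) = real_of_int n" for n
  proof (induction n rule: int_induct[where k = 0])
    case (step1 i) then show ?case using shift[of "real_of_int i"] by simp
  next
    case (step2 i) then show ?case using shift[of "real_of_int i - 1"] by simp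
  qed (use assms in simp)
  then have "real_of_int \<lfloor>x\<rfloor> \<le> F x" "F x \<le> real_of_int \<lceil>x\<rceil>"
    using monoD[OF assms(1)] by (metis of_int_floor_le, metis le_of_int_ceiling)
  then show "x - 1 < F x" "F x < x + 1" by linarith+
qed

context
  fixes F :: "real \<Rightarrow> real"
  assumes F: "mono F" "\<And>x. F (x + 1) = F x + 1" "F 0 = 0"
begin

lemma gen_inverse_le: "y < F x \<Longrightarrow> gen_inverse F y \<le> x"
  and le_gen_inverse: "(\<And>x. y < F x \<Longrightarrow> z \<le> x) \<Longrightarrow> z \<le> gen_inverse F y"
proof -
  have "y < F (y + 1)" for y using shift_equivariant_bounds(1)[OF F, of "y + 1"] by simp
  then have ne: "{x. y < F x} \<noteq> {}" by blast
  have "y - 1 \<le> x" if "y < F x" for x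
    using shift_equivariant_bounds(2)[OF F, of x] that by simp
  then have "bdd_below {x. y < F x}" by (intro bdd_belowI) auto
  then show "y < F x \<Longrightarrow> gen_inverse F y \<le> x"
    unfolding gen_inverse_def by (intro cInf_lower) auto
  show "(\<And>x. y < F x \<Longrightarrow> z \<le> x) \<Longrightarrow> z \<le> gen_inverse F y"
    unfolding gen_inverse_def using ne by (intro cInf_greatest) auto
qed

lemma gen_inverse_bounds: "y - 1 \<le> gen_inverse F y" "gen_inverse F y \<le> y + 1"
proof -
  show "y - 1 \<le> gen_inverse F y"
    by (rule le_gen_inverse) (use shift_equivariant_bounds(2)[OF F] in \<open>smt (verit)\<close>)
  show "gen_inverse F y \<le> y + 1"
    by (rule gen_inverse_le) (use shift_equivariant_bounds(1)[OF F, of "y + 1"] in simp)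
qed

lemma mono_gen_inverse: "mono (gen_inverse F)"
  by (intro monoI le_gen_inverse gen_inverse_le) simp

lemma gen_inverse_shift: "gen_inverse F (y + 1) = gen_inverse F y + 1"
proof (rule antisym)
  have "gen_inverse F (y + 1) - 1 \<le> gen_inverse F y"
    using gen_inverse_le[of "y + 1"] F(2) by (intro le_gen_inverse) (smt (verit))
  then show "gen_inverse F (y + 1) \<le> gen_inverse F y + 1" by simp
  show "gen_inverse F y + 1 \<le> gen_inverse F (y + 1)"
  proof (rule le_gen_inverse)
    fix x assume "y + 1 < F x"
    then have "y < F (x - 1)" using F(2)[of "x - 1"] by simp
    from gen_inverse_le[OF this] show "gen_inverse F y + 1 \<le> x" by simp
  qed
qed

end

section \<open>The average cost as an integral over a period\<close>

lemma nn_integral_period_shift: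
  fixes p :: "real \<Rightarrow> ennreal"
  assumes [measurable]: "p \<in> borel_measurable borel" and per: "\<And>x. p (x + 1) = p x"
  shows "(\<integral>\<^sup>+v. p (v + a) * indicator {0..1} v \<partial>lborel) = (\<integral>\<^sup>+v. p v * indicator {0..1} v \<partial>lborel)"
proof -
  have Icc: "(\<integral>\<^sup>+v. p v * indicator {a..b} v \<partial>lborel) = (\<integral>\<^sup>+v. p v * indicator {a<..b} v \<partial>lborel)" for a b
    using AE_lborel_singleton[of a]
    by (intro nn_integral_cong_AE) (auto elim!: eventually_mono simp: indicator_def)
  have perz: "p (x + real_of_int n) = p x" for x n
  proof (induction n rule: int_induct[where k = 0])
    case (step1 i) then show ?case using per[of "x + real_of_int i"] by (simp add: add.assoc)
  next
    case (step2 i) then show ?case using per[of "x + real_of_int i - 1"] by (simp add: algebra_simps)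
  qed simp
  define b where "b = frac a"
  have b: "0 \<le> b" "b < 1" by (simp_all add: b_def frac_lt_1)
  have "p (v + a) = p (v + b)" for v
    using perz[of "v + b" "\<lfloor>a\<rfloor>"] by (simp add: b_def frac_def)
  then have "(\<integral>\<^sup>+v. p (v + a) * indicator {0..1} v \<partial>lborel) = (\<integral>\<^sup>+v. p (b + 1 * v) * indicator {b..b + 1} (b + 1 * v) \<partial>lborel)"
    by (intro nn_integral_cong) (auto simp: indicator_def add.commute)
  also have "\<dots> = (\<integral>\<^sup>+v. p v * indicator {b..b + 1} v \<partial>lborel)"
    by (subst (2) nn_integral_real_affine[where c = 1 and t = b]) auto
  also have "\<dots> = (\<integral>\<^sup>+v. p v * indicator {b<..b + 1} v \<partial>lborel)" by (rule Icc)
  also have "\<dots> = (\<integral>\<^sup>+v. p v * indicator {b<..1} v + p v * indicator {1<..b + 1} v \<partial>lborel)"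
    using b by (intro nn_integral_cong) (auto simp: indicator_def)
  also have "\<dots> = (\<integral>\<^sup>+v. p v * indicator {b<..1} v \<partial>lborel) + (\<integral>\<^sup>+v. p v * indicator {1<..b + 1} v \<partial>lborel)"
    by (intro nn_integral_add) auto
  also have "(\<integral>\<^sup>+v. p v * indicator {1<..b + 1} v \<partial>lborel) = (\<integral>\<^sup>+v. p (1 + 1 * v) * indicator {1<..b + 1} (1 + 1 * v) \<partial>lborel)"
    by (subst nn_integral_real_affine[where c = 1 and t = 1]) auto
  also have "\<dots> = (\<integral>\<^sup>+v. p v * indicator {0<..b} v \<partial>lborel)"
    using per by (intro nn_integral_cong) (auto simp: indicator_def add.commute)
  also have "(\<integral>\<^sup>+v. p v * indicator {b<..1} v \<partial>lborel) + (\<integral>\<^sup>+v. p v * indicator {0<..b} v \<partial>lborel)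
      = (\<integral>\<^sup>+v. p v * indicator {b<..1} v + p v * indicator {0<..b} v \<partial>lborel)"
    by (intro nn_integral_add[symmetric]) auto
  also have "\<dots> = (\<integral>\<^sup>+v. p v * indicator {0<..1} v \<partial>lborel)"
    using b by (intro nn_integral_cong) (auto simp: indicator_def)
  finally show ?thesis by (simp add: Icc)
qed

text \<open>A jointly lower semicontinuous, strictly Monge cost that is invariant under the diagonal
  shift by \<open>1\<close> and tends to infinity with the distance of its arguments.\<close>

locale monge_cost =
  fixes c :: "real \<Rightarrow> real \<Rightarrow> real"
  assumes lsc: "lower_semicontinuous (\<lambda>(x, y). c x y)"
    and bounded_below: "\<exists>m. \<forall>x y. m \<le> c x y"
    and monge: "monge c"
    and shift: "integer_shift_invariant c"
    and growth: "growth_condition c"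
begin

lemma monge_less: "x1 < x2 \<Longrightarrow> y1 < y2 \<Longrightarrow> c x1 y1 + c x2 y2 < c x1 y2 + c x2 y1"
  using monge by (auto simp: monge_def)

lemma monge_le:
  assumes "x1 \<le> x2" "y1 \<le> y2"
  shows "c x1 y1 + c x2 y2 \<le> c x1 y2 + c x2 y1"
  using monge_less[of x1 x2 y1 y2] assms by (cases "x1 = x2 \<or> y1 = y2") auto

lemma cost_shift: "c (x + 1) (y + 1) = c x y"
  using shift by (simp add: integer_shift_invariant_def)

lemma open_cost_greater: "open {p. a < (\<lambda>(x, y). c x y) p}"
  using lsc by (simp add: lower_semicontinuous_def)

lemma ex_lower_bound: "\<exists>k\<ge>0. \<forall>x y. - k \<le> c x y"
proof -
  obtain m where "\<And>x y. m \<le> c x y" using bounded_below by blast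
  then have "\<And>x y. - \<bar>m\<bar> \<le> c x y" by (smt (verit))
  then show ?thesis by (intro exI[of _ "\<bar>m\<bar>"]) simp
qed

end

text \<open>A cost together with two nondecreasing functions that commute with the shift by \<open>1\<close> and
  vanish at \<open>0\<close>; of the measures only these properties of their distribution functions matter.\<close>

locale periodic_transport = monge_cost +
  fixes F0 F1 :: "real \<Rightarrow> real"
  assumes F0: "mono F0" "\<And>x. F0 (x + 1) = F0 x + 1" "F0 0 = 0"
    and F1: "mono F1" "\<And>x. F1 (x + 1) = F1 x + 1" "F1 0 = 0"
begin

abbreviation "h \<equiv> transported_cost c F0 F1"

lemma transported_cost_shift: "h (v + 1) (w + 1) = h v w"
  by (simp add: transported_cost_def gen_inverse_shift[OF F0] gen_inverse_shift[OF F1] cost_shift)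

lemma transported_cost_monge:
  "v1 \<le> v2 \<Longrightarrow> w1 \<le> w2 \<Longrightarrow> h v1 w1 + h v2 w2 \<le> h v1 w2 + h v2 w1"
  unfolding transported_cost_def
  by (intro monge_le monoD[OF mono_gen_inverse] F0 F1)

lemma transported_cost_measurable [measurable]:
  "(\<lambda>v. h (v + a) (v + b)) \<in> borel_measurable borel"
proof -
  have "(\<lambda>(x, y). c x y) \<in> borel_measurable borel"
    using open_cost_greater by (intro borel_measurableI_greater borel_open) auto
  moreover have "(\<lambda>v. gen_inverse F0 (v + a)) \<in> borel_measurable borel"
    "(\<lambda>v. gen_inverse F1 (v + b)) \<in> borel_measurable borel"
    using mono_gen_inverse[OF F0] mono_gen_inverse[OF F1]
    by (auto intro!: borel_measurable_mono simp: mono_def)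
  ultimately have "(\<lambda>v. (\<lambda>(x, y). c x y) (gen_inverse F0 (v + a), gen_inverse F1 (v + b)))
      \<in> borel_measurable borel"
    by (intro measurable_compose[OF borel_measurable_Pair])
  then show ?thesis by (simp add: transported_cost_def)
qed

lemma transported_cost_window:
  assumes "v \<in> {0..1}"
  shows "\<exists>u1\<in>{-1..2}. \<exists>u2\<in>{\<theta> - 1..\<theta> + 2}. h v (v + \<theta>) = c u1 u2"
proof (intro bexI)
  show "h v (v + \<theta>) = c (gen_inverse F0 v) (gen_inverse F1 (v + \<theta>))"
    by (simp add: transported_cost_def)
qed (use assms gen_inverse_bounds[OF F0, of v] gen_inverse_bounds[OF F1, of "v + \<theta>"] in auto)

text \<open>A constant \<open>k\<close> that makes the cost nonnegative turns the average cost into a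
  Lebesgue integral of a nonnegative function.\<close>

definition shifted_avg :: "real \<Rightarrow> real \<Rightarrow> ennreal" where
  "shifted_avg k \<theta> = (\<integral>\<^sup>+v. ennreal (h v (v + \<theta>) + k) * indicator {0..1} v \<partial>lborel)"

context
  fixes k :: real
  assumes k: "0 \<le> k" "\<And>x y. - k \<le> c x y"
begin

lemma transported_cost_ge: "- k \<le> h v w"
  by (simp add: transported_cost_def k)

lemma avg_cost_eq: "avg_cost c F0 F1 \<theta> = enn2ereal (shifted_avg k \<theta>) - ereal k"
proof -
  let ?f = "\<lambda>v. h v (v + \<theta>)"
  have [measurable]: "?f \<in> borel_measurable borel"
    using transported_cost_measurable[of 0 \<theta>] by simp
  have restr: "(\<integral>\<^sup>+v. g v \<partial>restrict_space lborel {0..1}) = (\<integral>\<^sup>+v. g v * indicator {0..1} v \<partial>lborel)"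
    for g :: "real \<Rightarrow> ennreal"
    by (intro nn_integral_restrict_space) simp
  define P N where "P = (\<integral>\<^sup>+v. ennreal (?f v) * indicator {0..1} v \<partial>lborel)"
    and "N = (\<integral>\<^sup>+v. ennreal (- ?f v) * indicator {0..1} v \<partial>lborel)"
  have const: "(\<integral>\<^sup>+v. ennreal k * indicator {0..1::real} v \<partial>lborel) = ennreal k"
    by (simp add: nn_integral_cmult)
  have "N \<le> (\<integral>\<^sup>+v. ennreal k * indicator {0..1::real} v \<partial>lborel)"
    unfolding N_def using transported_cost_ge
    by (intro nn_integral_mono mult_right_mono ennreal_leI) (auto simp: minus_le_iff)
  then have "N \<noteq> \<infinity>" unfolding const using ennreal_less_top[of k]
    by (auto simp: top_unique)
  have "P + ennreal k = (\<integral>\<^sup>+v. ennreal (?f v) * indicator {0..1} v + ennreal k * indicator {0..1} v \<partial>lborel)"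
    unfolding P_def by (subst nn_integral_add) (auto simp: const)
  also have "\<dots> = (\<integral>\<^sup>+v. ennreal (- ?f v) * indicator {0..1} v + ennreal (?f v + k) * indicator {0..1} v \<partial>lborel)"
  proof (intro nn_integral_cong)
    fix v
    have "ennreal (?f v) + ennreal k = ennreal (- ?f v) + ennreal (?f v + k)"
      using k(1) transported_cost_ge[of v "v + \<theta>"]
      by (cases "0 \<le> ?f v") (simp_all add: ennreal_neg flip: ennreal_plus)
    then show "ennreal (?f v) * indicator {0..1} v + ennreal k * indicator {0..1} v
        = ennreal (- ?f v) * indicator {0..1} v + ennreal (?f v + k) * indicator {0..1} v"
      by (simp flip: distrib_right)
  qed
  also have "\<dots> = N + shifted_avg k \<theta>"
    unfolding N_def shifted_avg_def by (subst nn_integral_add) auto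
  finally have "enn2ereal P + ereal k = enn2ereal N + enn2ereal (shifted_avg k \<theta>)"
    using k(1) by (metis plus_ennreal.rep_eq enn2ereal_ennreal)
  moreover have "avg_cost c F0 F1 \<theta> = enn2ereal P - enn2ereal N"
    unfolding avg_cost_def ext_integral_def restr P_def N_def ..
  moreover have "\<bar>enn2ereal N\<bar> \<noteq> \<infinity>" "enn2ereal P \<noteq> -\<infinity>"
    using \<open>N \<noteq> \<infinity>\<close> by (auto simp: enn2ereal_eq_top_iff)
  ultimately show ?thesis
    by (cases "enn2ereal P"; cases "enn2ereal N"; cases "enn2ereal (shifted_avg k \<theta>)") auto
qed

lemma shifted_avg_midpoint:
  assumes "0 \<le> d"
  shows "shifted_avg k m + shifted_avg k m \<le> shifted_avg k (m + d) + shifted_avg k (m - d)"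
proof -
  define g where "g v w = ennreal (h v w + k)" for v w
  have [measurable]: "(\<lambda>v. g (v + a) (v + b)) \<in> borel_measurable borel" for a b
    unfolding g_def by measurable
  from this[of 0] have [measurable]: "(\<lambda>v. g v (v + b)) \<in> borel_measurable borel" for b
    by simp
  let ?I = "\<lambda>f. \<integral>\<^sup>+v. f v * indicator {0..1::real} v \<partial>lborel"
  have avg: "shifted_avg k \<theta> = ?I (\<lambda>v. g v (v + \<theta>))" for \<theta>
    by (simp add: shifted_avg_def g_def)
  have avg': "shifted_avg k \<theta> = ?I (\<lambda>v. g (v + d) (v + (d + \<theta>)))" for \<theta>
  proof -
    have "g (v + 1) (v + 1 + \<theta>) = g v (v + \<theta>)" for v
      using transported_cost_shift[of v "v + \<theta>"] by (simp add: g_def add_ac)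
    then have "?I (\<lambda>v. g (v + d) (v + d + \<theta>)) = ?I (\<lambda>v. g v (v + \<theta>))"
      by (intro nn_integral_period_shift) auto
    then show ?thesis by (simp add: avg add.assoc)
  qed
  have "shifted_avg k m + shifted_avg k m
      = ?I (\<lambda>v. g v (v + m)) + ?I (\<lambda>v. g (v + d) (v + (d + m)))"
    using avg[of m] avg'[of m] by simp
  also have "\<dots> = ?I (\<lambda>v. g v (v + m) + g (v + d) (v + (d + m)))"
    by (subst nn_integral_add[symmetric]) (auto simp: distrib_right)
  also have "\<dots> \<le> ?I (\<lambda>v. g v (v + (m + d)) + g (v + d) (v + m))"
  proof (intro nn_integral_mono mult_right_mono)
    fix v
    have "h v (v + m) + h (v + d) (v + (d + m)) \<le> h v (v + (m + d)) + h (v + d) (v + m)"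
      using transported_cost_monge[of v "v + d" "v + m" "v + (d + m)"] assms
      by (simp add: add.commute)
    moreover have "0 \<le> h v w + k" for v w using transported_cost_ge[of v w] by simp
    ultimately show "g v (v + m) + g (v + d) (v + (d + m)) \<le> g v (v + (m + d)) + g (v + d) (v + m)"
      unfolding g_def by (simp flip: ennreal_plus add: ennreal_leI)
  qed simp
  also have "\<dots> = ?I (\<lambda>v. g v (v + (m + d))) + ?I (\<lambda>v. g (v + d) (v + m))"
    by (subst nn_integral_add[symmetric]) (auto simp: distrib_right)
  also have "\<dots> = shifted_avg k (m + d) + shifted_avg k (m - d)"
    using avg[of "m + d"] avg'[of "m - d"] by simp
  finally show ?thesis .
qed

text \<open>Fatou's lemma applies because the inverse distribution function, being monotone, is
  continuous off a countable set.\<close>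

lemma shifted_avg_lsc: "open {\<theta>. a < shifted_avg k \<theta>}"
proof -
  have "closed {\<theta>. shifted_avg k \<theta> \<le> a}"
    unfolding closed_sequential_limits
  proof (intro allI impI)
    fix x :: "nat \<Rightarrow> real" and \<theta>
    assume *: "(\<forall>n. x n \<in> {\<theta>. shifted_avg k \<theta> \<le> a}) \<and> x \<longlonglongrightarrow> \<theta>"
    define D where "D = {w. \<not> isCont (gen_inverse F1) w}"
    have "countable ((\<lambda>w. w - \<theta>) ` D)"
      unfolding D_def by (intro countable_image mono_ctble_discont mono_gen_inverse F1)
    then have "AE v in lborel. v \<notin> (\<lambda>w. w - \<theta>) ` D"
      by (intro AE_not_in countable_imp_null_set_lborel)
    then have AE: "AE v in lborel. ennreal (h v (v + \<theta>) + k) * indicator {0..1} v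
        \<le> liminf (\<lambda>n. ennreal (h v (v + x n) + k) * indicator {0..1} v)"
    proof (rule eventually_mono)
      fix v assume "v \<notin> (\<lambda>w. w - \<theta>) ` D"
      then have "isCont (gen_inverse F1) (v + \<theta>)"
        by (force simp: D_def image_iff)
      then have "(\<lambda>n. gen_inverse F1 (v + x n)) \<longlonglongrightarrow> gen_inverse F1 (v + \<theta>)"
        using * by (intro isCont_tendsto_compose[where g = "gen_inverse F1"] tendsto_intros) auto
      then have lim: "(\<lambda>n. (gen_inverse F0 v, gen_inverse F1 (v + x n)))
          \<longlonglongrightarrow> (gen_inverse F0 v, gen_inverse F1 (v + \<theta>))"
        by (intro tendsto_intros)
      have "ennreal (h v (v + \<theta>) + k) \<le> liminf (\<lambda>n. ennreal (h v (v + x n) + k))"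
        unfolding le_Liminf_iff
      proof (intro allI impI)
        fix y assume y: "y < ennreal (h v (v + \<theta>) + k)"
        then obtain r where r: "y = ennreal r" "0 \<le> r" by (cases y) auto
        then have "r - k < h v (v + \<theta>)" using y by (simp add: ennreal_less_iff)
        then have "\<forall>\<^sub>F n in sequentially. r - k < h v (v + x n)"
          using topological_tendstoD[OF lim open_cost_greater[of "r - k"]]
          by (simp add: transported_cost_def)
        then show "\<forall>\<^sub>F n in sequentially. y < ennreal (h v (v + x n) + k)"
          by (rule eventually_mono) (use r in \<open>simp add: ennreal_less_iff\<close>)
      qed
      then show "ennreal (h v (v + \<theta>) + k) * indicator {0..1} v
        \<le> liminf (\<lambda>n. ennreal (h v (v + x n) + k) * indicator {0..1} v)"
        by (simp add: indicator_def)
    qed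
    have [measurable]: "(\<lambda>v. h v (v + b)) \<in> borel_measurable borel" for b
      using transported_cost_measurable[of 0 b] by simp
    have "shifted_avg k \<theta>
        \<le> (\<integral>\<^sup>+v. liminf (\<lambda>n. ennreal (h v (v + x n) + k) * indicator {0..1} v) \<partial>lborel)"
      unfolding shifted_avg_def by (rule nn_integral_mono_AE[OF AE])
    also have "\<dots> \<le> liminf (\<lambda>n. shifted_avg k (x n))"
      unfolding shifted_avg_def by (intro nn_integral_liminf) auto
    also have "\<dots> \<le> limsup (\<lambda>n. shifted_avg k (x n))"
      by (intro Liminf_le_Limsup) simp
    also have "\<dots> \<le> a" using * by (intro Limsup_bounded) auto
    finally show "\<theta> \<in> {\<theta>. shifted_avg k \<theta> \<le> a}" by simp
  qed
  then show ?thesis by (simp add: closed_def Collect_neg_eq[symmetric] not_le)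
qed

end

lemma avg_cost_lsc: "open {\<theta>. a < avg_cost c F0 F1 \<theta>}"
proof -
  obtain k where k: "0 \<le> k" "\<And>x y. - k \<le> c x y" using ex_lower_bound by blast
  have "a < enn2ereal z - ereal k \<longleftrightarrow> a + ereal k < 0 \<or> e2ennreal (a + ereal k) < z" for z
  proof -
    have "a < enn2ereal z - ereal k \<longleftrightarrow> a + ereal k < enn2ereal z"
      by (cases a; cases "enn2ereal z") auto
    moreover have "a + ereal k < enn2ereal z \<longleftrightarrow> e2ennreal (a + ereal k) < z"
      if "0 \<le> a + ereal k"
      using that by (metis enn2ereal_e2ennreal less_ennreal.rep_eq)
    ultimately show ?thesis
      using enn2ereal_nonneg[of z] by (meson leI less_le_trans)
  qed
  then have "{\<theta>. a < avg_cost c F0 F1 \<theta>}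
      = (if a + ereal k < 0 then UNIV else {\<theta>. e2ennreal (a + ereal k) < shifted_avg k \<theta>})"
    by (auto simp: avg_cost_eq[OF k])
  then show ?thesis using shifted_avg_lsc[OF k] by simp
qed

lemma avg_cost_ext_convex: "ext_convex (avg_cost c F0 F1)"
proof (rule ext_convex_if_midpoint[OF avg_cost_lsc])
  obtain k where k: "0 \<le> k" "\<And>x y. - k \<le> c x y" using ex_lower_bound by blast
  show "avg_cost c F0 F1 \<theta> \<noteq> -\<infinity>" for \<theta>
    by (cases "enn2ereal (shifted_avg k \<theta>)") (auto simp: avg_cost_eq[OF k])
  fix m d
  have "shifted_avg k m + shifted_avg k m \<le> shifted_avg k (m + d) + shifted_avg k (m - d)"
    using shifted_avg_midpoint[OF k, of d m] shifted_avg_midpoint[OF k, of "- d" m]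
    by (cases "0 \<le> d") (auto simp: add.commute)
  then have "enn2ereal (shifted_avg k m) + enn2ereal (shifted_avg k m)
      \<le> enn2ereal (shifted_avg k (m + d)) + enn2ereal (shifted_avg k (m - d))"
    by (simp add: less_eq_ennreal.rep_eq plus_ennreal.rep_eq)
  then show "avg_cost c F0 F1 m + avg_cost c F0 F1 m
      \<le> avg_cost c F0 F1 (m + d) + avg_cost c F0 F1 (m - d)"
    unfolding avg_cost_eq[OF k]
    by (cases "enn2ereal (shifted_avg k m)"; cases "enn2ereal (shifted_avg k (m + d))";
        cases "enn2ereal (shifted_avg k (m - d))") auto
qed

lemma avg_cost_lower_bound:
  assumes "\<And>v. v \<in> {0..1} \<Longrightarrow> l \<le> h v (v + \<theta>)"
  shows "ereal l \<le> avg_cost c F0 F1 \<theta>"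
proof -
  obtain k where k: "0 \<le> k" "\<And>x y. - k \<le> c x y" using ex_lower_bound by blast
  have "ennreal (l + k) = (\<integral>\<^sup>+v. ennreal (l + k) * indicator {0..1::real} v \<partial>lborel)"
    by (simp add: nn_integral_cmult)
  also have "\<dots> \<le> shifted_avg k \<theta>"
    unfolding shifted_avg_def using assms
    by (intro nn_integral_mono) (auto simp: indicator_def intro!: ennreal_leI)
  finally have "enn2ereal (ennreal (l + k)) \<le> enn2ereal (shifted_avg k \<theta>)"
    by (simp add: less_eq_ennreal.rep_eq)
  moreover have "ereal (l + k) \<le> enn2ereal (ennreal (l + k))"
    by (cases "0 \<le> l + k") (simp_all add: enn2ereal_ennreal ennreal_neg zero_ennreal.rep_eq)
  ultimately have "ereal (l + k) \<le> enn2ereal (shifted_avg k \<theta>)" by order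
  then show ?thesis
    unfolding avg_cost_eq[OF k] by (cases "enn2ereal (shifted_avg k \<theta>)") auto
qed

lemma avg_cost_upper_bound:
  assumes "\<And>v. v \<in> {0..1} \<Longrightarrow> h v (v + \<theta>) \<le> l"
  shows "avg_cost c F0 F1 \<theta> \<le> ereal l"
proof -
  obtain k where k: "0 \<le> k" "\<And>x y. - k \<le> c x y" using ex_lower_bound by blast
  have "- k \<le> h 0 \<theta>" by (rule transported_cost_ge[OF k])
  then have pos: "0 \<le> l + k" using assms[of 0] by simp
  have "shifted_avg k \<theta> \<le> (\<integral>\<^sup>+v. ennreal (l + k) * indicator {0..1::real} v \<partial>lborel)"
    unfolding shifted_avg_def using assms
    by (intro nn_integral_mono) (auto simp: indicator_def intro!: ennreal_leI)
  also have "\<dots> = ennreal (l + k)" by (simp add: nn_integral_cmult)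
  finally have "enn2ereal (shifted_avg k \<theta>) \<le> ereal (l + k)"
    using pos by (simp add: less_eq_ennreal.rep_eq enn2ereal_ennreal)
  then show ?thesis
    unfolding avg_cost_eq[OF k] by (cases "enn2ereal (shifted_avg k \<theta>)") auto
qed

end

section \<open>Extreme costs over windows\<close>

context monge_cost
begin

lemma lower_cost_attained: "\<exists>u1\<in>{-1..2}. \<exists>u2\<in>{\<theta> - 1..\<theta> + 2}. lower_cost c \<theta> = c u1 u2"
  and lower_cost_le: "u1 \<in> {-1..2} \<Longrightarrow> u2 \<in> {\<theta> - 1..\<theta> + 2} \<Longrightarrow> lower_cost c \<theta> \<le> c u1 u2"
proof -
  let ?W = "{-1..2::real} \<times> {\<theta> - 1..\<theta> + 2}" and ?c = "\<lambda>(u1, u2). c u1 u2"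
  obtain p where p: "p \<in> ?W" "\<And>q. q \<in> ?W \<Longrightarrow> ?c p \<le> ?c q"
    using lsc_attains_inf[of ?W ?c] open_cost_greater by (auto simp: compact_Times)
  then have "lower_cost c \<theta> = ?c p"
    unfolding lower_cost_def by (intro cInf_eq_minimum) auto
  with p show "\<exists>u1\<in>{-1..2}. \<exists>u2\<in>{\<theta> - 1..\<theta> + 2}. lower_cost c \<theta> = c u1 u2"
    and "u1 \<in> {-1..2} \<Longrightarrow> u2 \<in> {\<theta> - 1..\<theta> + 2} \<Longrightarrow> lower_cost c \<theta> \<le> c u1 u2"
    by (fastforce)+
qed

lemma le_upper_cost: "u1 \<in> {-1..2} \<Longrightarrow> u2 \<in> {\<theta> - 1..\<theta> + 2} \<Longrightarrow> ereal (c u1 u2) \<le> upper_cost c \<theta>"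
  unfolding upper_cost_def by (intro SUP_upper2[of "(u1, u2)"]) auto

lemma upper_cost_le:
  "(\<And>u1 u2. u1 \<in> {-1..2} \<Longrightarrow> u2 \<in> {\<theta> - 1..\<theta> + 2} \<Longrightarrow> ereal (c u1 u2) \<le> b) \<Longrightarrow> upper_cost c \<theta> \<le> b"
  unfolding upper_cost_def by (intro SUP_least) auto

lemma upper_cost_le_real_iff:
  "upper_cost c \<theta> \<le> ereal M \<longleftrightarrow> (\<forall>u1\<in>{-1..2}. \<forall>u2\<in>{\<theta> - 1..\<theta> + 2}. c u1 u2 \<le> M)"
  using le_upper_cost upper_cost_le[of \<theta> "ereal M"] by (metis ereal_less_eq(3) order_trans)

lemma upper_cost_finite_iff: "upper_cost c \<theta> < \<infinity> \<longleftrightarrow> (\<exists>M. upper_cost c \<theta> \<le> ereal M)"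
  by (cases "upper_cost c \<theta>") auto

text \<open>Neighbouring windows overlap, and the strict Monge inequality keeps the cost from being
  constant on the overlap.\<close>

lemma lower_upper_gap:
  "\<exists>e>0. \<forall>\<theta>'. \<bar>\<theta>' - \<theta>\<bar> \<le> 1 \<longrightarrow> ereal (lower_cost c \<theta> + e) \<le> upper_cost c \<theta>'"
proof -
  have "c 0 \<theta> + c 1 (\<theta> + 1) < c 0 (\<theta> + 1) + c 1 \<theta>" by (rule monge_less) auto
  moreover have "lower_cost c \<theta> \<le> c 0 \<theta>" "lower_cost c \<theta> \<le> c 1 (\<theta> + 1)"
    by (auto intro: lower_cost_le)
  ultimately have "lower_cost c \<theta> < c 0 (\<theta> + 1) \<or> lower_cost c \<theta> < c 1 \<theta>" by linarith
  then obtain u1 u2 where u: "u1 \<in> {0, 1}" "u2 \<in> {\<theta>, \<theta> + 1}" "lower_cost c \<theta> < c u1 u2"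
    by blast
  show ?thesis
  proof (intro exI[of _ "c u1 u2 - lower_cost c \<theta>"] conjI allI impI)
    fix \<theta>' assume "\<bar>\<theta>' - \<theta>\<bar> \<le> 1"
    then have "ereal (c u1 u2) \<le> upper_cost c \<theta>'"
      using u by (intro le_upper_cost) auto
    then show "ereal (lower_cost c \<theta> + (c u1 u2 - lower_cost c \<theta>)) \<le> upper_cost c \<theta>'" by simp
  qed (use u in simp)
qed

lemma lower_cost_le_upper_cost:
  assumes "\<bar>\<theta>' - \<theta>\<bar> \<le> 1"
  shows "ereal (lower_cost c \<theta>) \<le> upper_cost c \<theta>'"
proof -
  obtain e where "0 < e" "ereal (lower_cost c \<theta> + e) \<le> upper_cost c \<theta>'"
    using lower_upper_gap[of \<theta>] assms by blast
  then show ?thesis by (cases "upper_cost c \<theta>'") auto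
qed

lemma lower_cost_coercive: "\<exists>R. \<forall>\<theta>. R \<le> \<bar>\<theta>\<bar> \<longrightarrow> P \<le> lower_cost c \<theta>"
proof -
  obtain R where R: "\<And>x y. R \<le> \<bar>x - y\<bar> \<Longrightarrow> P \<le> c x y"
    using growth unfolding growth_condition_def by blast
  have "P \<le> lower_cost c \<theta>" if "R + 3 \<le> \<bar>\<theta>\<bar>" for \<theta>
  proof -
    obtain u1 u2 where u: "u1 \<in> {-1..2}" "u2 \<in> {\<theta> - 1..\<theta> + 2}" "lower_cost c \<theta> = c u1 u2"
      using lower_cost_attained by blast
    then have "R \<le> \<bar>u1 - u2\<bar>" using that by auto
    with R u show ?thesis by simp
  qed
  then show ?thesis by blast
qed

lemma closed_lower_cost_sublevel: "closed {\<theta>. lower_cost c \<theta> \<le> a}"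
proof -
  let ?f = "\<lambda>x. (fst (fst x), snd x + snd (fst x)) :: real \<times> real"
  let ?T = "{x. (\<lambda>(x, y). c x y) (?f x) \<le> a}" and ?S = "{-1..2::real} \<times> {-1..2::real}"
  have "open (?f -` {p. a < (\<lambda>(x, y). c x y) p})"
    by (intro open_vimage open_cost_greater continuous_intros)
  moreover have "- ?T = ?f -` {p. a < (\<lambda>(x, y). c x y) p}" by auto
  ultimately have "closed ?T" by (simp only: closed_def)
  then have "closed {\<theta>. \<exists>x. x \<in> ?S \<and> (x, \<theta>) \<in> ?T}"
    by (intro closed_compact_projection compact_Times compact_Icc)
  also have "{\<theta>. \<exists>x. x \<in> ?S \<and> (x, \<theta>) \<in> ?T} = {\<theta>. lower_cost c \<theta> \<le> a}"
  proof (intro set_eqI iffI)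
    fix \<theta> assume "\<theta> \<in> {\<theta>. \<exists>x. x \<in> ?S \<and> (x, \<theta>) \<in> ?T}"
    then obtain u s where "u \<in> {-1..2}" "s \<in> {-1..2}" "c u (\<theta> + s) \<le> a" by auto
    then show "\<theta> \<in> {\<theta>. lower_cost c \<theta> \<le> a}"
      using lower_cost_le[of u "\<theta> + s" \<theta>] by simp
  next
    fix \<theta> assume *: "\<theta> \<in> {\<theta>. lower_cost c \<theta> \<le> a}"
    obtain u1 u2 where u: "u1 \<in> {-1..2}" "u2 \<in> {\<theta> - 1..\<theta> + 2}" "lower_cost c \<theta> = c u1 u2"
      using lower_cost_attained by blast
    with * show "\<theta> \<in> {\<theta>. \<exists>x. x \<in> ?S \<and> (x, \<theta>) \<in> ?T}"
      by (intro CollectI exI[of _ "(u1, u2 - \<theta>)"]) auto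
  qed
  finally show ?thesis .
qed

lemma upper_cost_lsc: "open {\<theta>. a < upper_cost c \<theta>}"
proof -
  have eq: "{\<theta>. a < upper_cost c \<theta>}
      = (\<Union>u\<in>{-1..2}. \<Union>s\<in>{-1..2}. {\<theta>. a < ereal (c u (\<theta> + s))})"
  proof (intro set_eqI iffI)
    fix \<theta> assume "\<theta> \<in> {\<theta>. a < upper_cost c \<theta>}"
    then obtain u1 u2 where "u1 \<in> {-1..2}" "u2 \<in> {\<theta> - 1..\<theta> + 2}" "a < ereal (c u1 u2)"
      using upper_cost_le[of \<theta> a] by (metis mem_Collect_eq not_le)
    then show "\<theta> \<in> (\<Union>u\<in>{-1..2}. \<Union>s\<in>{-1..2}. {\<theta>. a < ereal (c u (\<theta> + s))})"
      by (intro UN_I[of u1] UN_I[of "u2 - \<theta>"]) auto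
  next
    fix \<theta> assume "\<theta> \<in> (\<Union>u\<in>{-1..2}. \<Union>s\<in>{-1..2}. {\<theta>. a < ereal (c u (\<theta> + s))})"
    then obtain u s where "u \<in> {-1..2}" "s \<in> {-1..2}" "a < ereal (c u (\<theta> + s))" by auto
    then show "\<theta> \<in> {\<theta>. a < upper_cost c \<theta>}"
      using le_upper_cost[of u "\<theta> + s" \<theta>] by (auto intro: less_le_trans)
  qed
  have "open {\<theta>. a < ereal (c u (\<theta> + s))}" for u s
  proof (cases a)
    case (real r)
    have "open ((\<lambda>\<theta>. (u, \<theta> + s)) -` {p. r < (\<lambda>(x, y). c x y) p})"
      by (intro open_vimage open_cost_greater continuous_intros)
    then show ?thesis using real by (simp add: vimage_def)
  qed auto
  then show ?thesis unfolding eq by blast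
qed

lemma min_upper_cost_attained: "\<exists>\<theta>. upper_cost c \<theta> = min_upper_cost c"
proof (cases "min_upper_cost c = \<infinity>")
  case True
  then have "\<infinity> \<le> upper_cost c 0" unfolding min_upper_cost_def by (metis INF_lower UNIV_I)
  with True show ?thesis by auto
next
  case False
  then obtain \<theta>1 where "upper_cost c \<theta>1 \<noteq> \<infinity>"
    unfolding min_upper_cost_def by (metis INF_eq_const UNIV_not_empty ex_in_conv)
  then obtain P where P: "upper_cost c \<theta>1 \<le> ereal P"
    using upper_cost_finite_iff[of \<theta>1] by (auto simp: less_top)
  obtain R where R: "\<And>\<theta>. R \<le> \<bar>\<theta>\<bar> \<Longrightarrow> P \<le> lower_cost c \<theta>"
    using lower_cost_coercive by blast
  define Q where "Q = max R \<bar>\<theta>1\<bar>"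
  have "{- Q..Q} \<noteq> {}" "\<theta>1 \<in> {- Q..Q}" unfolding Q_def by auto
  then obtain \<theta>0 where \<theta>0: "\<And>\<theta>. \<theta> \<in> {- Q..Q} \<Longrightarrow> upper_cost c \<theta>0 \<le> upper_cost c \<theta>"
    using lsc_attains_inf[OF compact_Icc _ upper_cost_lsc] by metis
  have "upper_cost c \<theta>0 \<le> upper_cost c \<theta>" for \<theta>
  proof (cases "\<theta> \<in> {- Q..Q}")
    case False
    then have "P \<le> lower_cost c \<theta>" by (intro R) (auto simp: Q_def)
    then have "upper_cost c \<theta>0 \<le> ereal (lower_cost c \<theta>)"
      using \<theta>0[OF \<open>\<theta>1 \<in> {- Q..Q}\<close>] P by (meson ereal_less_eq(3) order_trans)
    also have "\<dots> \<le> upper_cost c \<theta>" by (rule lower_cost_le_upper_cost) simp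
    finally show ?thesis .
  qed (rule \<theta>0)
  then have "upper_cost c \<theta>0 = min_upper_cost c"
    unfolding min_upper_cost_def by (intro antisym INF_greatest INF_lower) auto
  then show ?thesis ..
qed

text \<open>A real-valued cost may be unbounded above on a window, but not if it is bounded above on
  another window. By the Monge condition the corner sum
  \<open>c x1 y2 + c x2 y1 - c x1 y1 - c x2 y2\<close> over a rectangle grows with the rectangle; bounding it by
  the sum over a fixed larger rectangle bounds the cost at the upper left or the lower right corner
  by its values at the other three.\<close>

lemma corner_bound:
  assumes "a \<le> x" "x \<le> x'" "y' \<le> y" "y \<le> b"
  shows "c x y \<le> c x y' + c x' y - c x' y' + (c a b + c x' y' - c a y' - c x' b)"
  using monge_le[of a x y' y] monge_le[of a x' y b] assms by linarith

lemma corner_bound':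
  assumes "x' \<le> x" "x \<le> b" "a \<le> y" "y \<le> y'"
  shows "c x y \<le> c x y' + c x' y - c x' y' + (c b a + c x' y' - c b y' - c x' a)"
  using monge_le[of x b y y'] monge_le[of x' b a y] assms by linarith

lemma upper_cost_finite_step:
  assumes "upper_cost c \<theta> < \<infinity>" "\<bar>\<theta>' - \<theta>\<bar> \<le> 1"
  shows "upper_cost c \<theta>' < \<infinity>"
proof -
  obtain M where M: "\<And>u1 u2. u1 \<in> {-1..2} \<Longrightarrow> u2 \<in> {\<theta> - 1..\<theta> + 2} \<Longrightarrow> c u1 u2 \<le> M"
    using assms(1) unfolding upper_cost_finite_iff upper_cost_le_real_iff by blast
  \<comment> \<open>\<open>D1\<close> and \<open>D2\<close> bound the cost on the strips above and below the window. The shift carries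
    the values on the edges \<open>u1 = 2\<close> and \<open>u1 = -1\<close> of the strips back into the window.\<close>
  define D1 where "D1 = 2 * M - c 2 \<theta> + (c (-1) (\<theta> + 3) + c 2 \<theta> - c (-1) \<theta> - c 2 (\<theta> + 3))"
  define D2 where "D2 = 2 * M - c (-1) \<theta> + (c 2 (\<theta> - 2) + c (-1) \<theta> - c 2 \<theta> - c (-1) (\<theta> - 2))"
  have "c u1 u2 \<le> max M (max D1 D2)" if u: "u1 \<in> {-1..2}" "u2 \<in> {\<theta>' - 1..\<theta>' + 2}" for u1 u2
  proof -
    consider "u2 \<in> {\<theta> - 1..\<theta> + 2}" | "u2 \<in> {\<theta> + 2..\<theta> + 3}" | "u2 \<in> {\<theta> - 2..\<theta> - 1}"
      using u(2) assms(2) by fastforce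
    then show ?thesis
    proof cases
      case 1
      then show ?thesis using M u(1) by (auto simp: le_max_iff_disj)
    next
      case 2
      have "c 2 u2 = c 1 (u2 - 1)" using cost_shift[of 1 "u2 - 1"] by simp
      then have "c 2 u2 \<le> M" "c u1 \<theta> \<le> M" using 2 u(1) by (auto intro: M)
      then have "c u1 u2 \<le> D1"
        using corner_bound[of "-1" u1 2 \<theta> u2 "\<theta> + 3"] 2 u(1) by (simp add: D1_def)
      then show ?thesis by simp
    next
      case 3
      have "c (-1) u2 = c 0 (u2 + 1)" using cost_shift[of "-1" u2] by simp
      then have "c (-1) u2 \<le> M" "c u1 \<theta> \<le> M" using 3 u(1) by (auto intro: M)
      then have "c u1 u2 \<le> D2"
        using corner_bound'[of "-1" u1 2 "\<theta> - 2" u2 \<theta>] 3 u(1) by (simp add: D2_def)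
      then show ?thesis by simp
    qed
  qed
  then show ?thesis unfolding upper_cost_finite_iff upper_cost_le_real_iff by blast
qed

lemma upper_cost_finite:
  assumes "upper_cost c \<theta> < \<infinity>"
  shows "upper_cost c \<theta>' < \<infinity>"
proof -
  have "upper_cost c \<theta>' < \<infinity>" if "\<bar>\<theta>' - \<theta>\<bar> \<le> real n" for n \<theta>'
    using that
  proof (induction n arbitrary: \<theta>')
    case (Suc n)
    define \<theta>'' where "\<theta>'' = \<theta> + max (- real n) (min (real n) (\<theta>' - \<theta>))"
    have "upper_cost c \<theta>'' < \<infinity>" by (rule Suc.IH) (auto simp: \<theta>''_def)
    moreover have "\<bar>\<theta>' - \<theta>''\<bar> \<le> 1" using Suc.prems by (auto simp: \<theta>''_def abs_le_iff max_def min_def)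
    ultimately show ?case by (rule upper_cost_finite_step)
  qed (use assms in simp)
  then show ?thesis using real_arch_simple by blast
qed

lemma min_upper_cost_finiteE:
  assumes "min_upper_cost c < \<infinity>"
  obtains m a where "min_upper_cost c = ereal m" "upper_cost c a = ereal m"
proof -
  obtain a where a: "upper_cost c a = min_upper_cost c" using min_upper_cost_attained by blast
  moreover have "upper_cost c a \<noteq> - \<infinity>" using lower_cost_le_upper_cost[of a a] by auto
  ultimately obtain m where "min_upper_cost c = ereal m"
    using assms by (cases "min_upper_cost c") auto
  with a show thesis by (intro that) auto
qed

lemma
  fixes S defines "S \<equiv> {\<theta>. ereal (lower_cost c \<theta>) \<le> min_upper_cost c}"
  assumes "min_upper_cost c < \<infinity>"
  shows sublevel_bdd_below: "bdd_below S" and sublevel_bdd_above: "bdd_above S"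
    and Inf_sublevel_in: "Inf S \<in> S" and Sup_sublevel_in: "Sup S \<in> S"
    and sublevel_spread: "upper_cost c a = min_upper_cost c \<Longrightarrow> Inf S < a \<and> a < Sup S"
proof -
  obtain m a0 where m: "min_upper_cost c = ereal m" "upper_cost c a0 = ereal m"
    using min_upper_cost_finiteE assms by blast
  have S: "S = {\<theta>. lower_cost c \<theta> \<le> m}" using m by (simp add: S_def)
  obtain R where R: "\<And>\<theta>. R \<le> \<bar>\<theta>\<bar> \<Longrightarrow> m + 1 \<le> lower_cost c \<theta>"
    using lower_cost_coercive by blast
  have SR: "\<bar>\<theta>\<bar> \<le> R" if "\<theta> \<in> S" for \<theta> using R[of \<theta>] that unfolding S by fastforce
  then have "S \<subseteq> {- R..R}" by force
  then show bdd: "bdd_below S" "bdd_above S" by (auto intro: bdd_below_mono bdd_above_mono)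
  have mem: "a - 1 \<in> S" "a + 1 \<in> S" if "upper_cost c a = min_upper_cost c" for a
    using lower_cost_le_upper_cost[of a "a - 1"] lower_cost_le_upper_cost[of a "a + 1"] that
    by (auto simp: S_def)
  show "Inf S < a \<and> a < Sup S" if "upper_cost c a = min_upper_cost c"
    using cInf_lower[OF mem(1)[OF that] bdd(1)] cSup_upper[OF mem(2)[OF that] bdd(2)] by simp
  have "S \<noteq> {}" using mem[of a0] m by auto
  moreover have "closed S" unfolding S by (rule closed_lower_cost_sublevel)
  ultimately show "Inf S \<in> S" "Sup S \<in> S"
    using bdd by (auto intro: closed_contains_Inf closed_contains_Sup)
qed

lemma
  assumes cont: "continuous_on UNIV (\<lambda>(x, y). c x y)"
  shows continuous_min_upper_cost_finite: "min_upper_cost c < \<infinity>"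
    and open_lower_cost_less: "open {\<theta>. lower_cost c \<theta> < a}"
proof -
  have "compact ((\<lambda>(x, y). c x y) ` ({-1..2} \<times> {0 - 1..0 + 2}))"
    by (intro compact_continuous_image compact_Times continuous_on_subset[OF cont]) auto
  then have "bdd_above ((\<lambda>(x, y). c x y) ` ({-1..2} \<times> {0 - 1..0 + 2}))"
    by (intro bounded_imp_bdd_above compact_imp_bounded)
  then obtain M where "\<And>p. p \<in> {-1..2} \<times> {0 - 1..0 + 2} \<Longrightarrow> (\<lambda>(x, y). c x y) p \<le> M"
    unfolding bdd_above_def by blast
  from this[of "(_, _)"] have "upper_cost c 0 \<le> ereal M"
    unfolding upper_cost_le_real_iff by auto
  then have "upper_cost c 0 < \<infinity>" unfolding upper_cost_finite_iff by blast
  moreover have "min_upper_cost c \<le> upper_cost c 0"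
    unfolding min_upper_cost_def by (rule INF_lower) simp
  ultimately show "min_upper_cost c < \<infinity>" by order
  have "{\<theta>. lower_cost c \<theta> < a} = (\<Union>u\<in>{-1..2}. \<Union>s\<in>{-1..2}. {\<theta>. c u (\<theta> + s) < a})"
  proof (intro set_eqI iffI)
    fix \<theta> assume *: "\<theta> \<in> {\<theta>. lower_cost c \<theta> < a}"
    obtain u1 u2 where u: "u1 \<in> {-1..2}" "u2 \<in> {\<theta> - 1..\<theta> + 2}" "lower_cost c \<theta> = c u1 u2"
      using lower_cost_attained by blast
    with * show "\<theta> \<in> (\<Union>u\<in>{-1..2}. \<Union>s\<in>{-1..2}. {\<theta>. c u (\<theta> + s) < a})"
      by (intro UN_I[of u1] UN_I[of "u2 - \<theta>"]) auto
  next
    fix \<theta> assume "\<theta> \<in> (\<Union>u\<in>{-1..2}. \<Union>s\<in>{-1..2}. {\<theta>. c u (\<theta> + s) < a})"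
    then obtain u s where "u \<in> {-1..2}" "s \<in> {-1..2}" "c u (\<theta> + s) < a" by auto
    then show "\<theta> \<in> {\<theta>. lower_cost c \<theta> < a}"
      using lower_cost_le[of u "\<theta> + s" \<theta>] by simp
  qed
  moreover have "open {\<theta>. c u (\<theta> + s) < a}" for u s
  proof -
    have "continuous_on UNIV (\<lambda>\<theta>. (\<lambda>(x, y). c x y) (u, \<theta> + s))"
      by (intro continuous_on_compose2[OF cont] continuous_intros) auto
    then show ?thesis by (intro open_Collect_less continuous_intros) simp_all
  qed
  ultimately show "open {\<theta>. lower_cost c \<theta> < a}" by (simp add: open_UN)
qed

text \<open>For a continuous cost, the level set of the lower cost has the same endpoints as the
  sublevel set.\<close>

lemma level_endpoints:
  fixes S S' defines "S \<equiv> {\<theta>. ereal (lower_cost c \<theta>) = min_upper_cost c}"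
    and "S' \<equiv> {\<theta>. ereal (lower_cost c \<theta>) \<le> min_upper_cost c}"
  assumes cont: "continuous_on UNIV (\<lambda>(x, y). c x y)"
  shows "S \<noteq> {} \<and> Inf S = Inf S' \<and> Sup S = Sup S'"
proof -
  note fin = continuous_min_upper_cost_finite[OF cont]
  obtain m where m: "min_upper_cost c = ereal m"
    using min_upper_cost_finiteE fin by blast
  let ?V = "{\<theta>. lower_cost c \<theta> < m}"
  have bdd: "bdd_below S'" "bdd_above S'" and mem: "Inf S' \<in> S'" "Sup S' \<in> S'"
    unfolding S'_def
    by (intro sublevel_bdd_below sublevel_bdd_above Inf_sublevel_in Sup_sublevel_in fin)+
  have "?V \<subseteq> S'" by (auto simp: S'_def m)
  \<comment> \<open>Were the lower cost below \<open>m\<close> at an endpoint of \<open>S'\<close>, then by continuity points beyond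
    that endpoint would belong to \<open>S'\<close>.\<close>
  have notV: "Inf S' \<notin> ?V" "Sup S' \<notin> ?V"
  proof -
    show "Inf S' \<notin> ?V"
    proof
      assume "Inf S' \<in> ?V"
      then obtain e where "0 < e" "ball (Inf S') e \<subseteq> ?V"
        using open_lower_cost_less[OF cont] open_contains_ball by metis
      moreover have "Inf S' - e / 2 \<in> ball (Inf S') e" using \<open>0 < e\<close> by (simp add: dist_real_def)
      ultimately have "Inf S' - e / 2 \<in> S'" using \<open>?V \<subseteq> S'\<close> by blast
      from cInf_lower[OF this bdd(1)] show False using \<open>0 < e\<close> by simp
    qed
    show "Sup S' \<notin> ?V"
    proof
      assume "Sup S' \<in> ?V"
      then obtain e where "0 < e" "ball (Sup S') e \<subseteq> ?V"
        using open_lower_cost_less[OF cont] open_contains_ball by metis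
      moreover have "Sup S' + e / 2 \<in> ball (Sup S') e" using \<open>0 < e\<close> by (simp add: dist_real_def)
      ultimately have "Sup S' + e / 2 \<in> S'" using \<open>?V \<subseteq> S'\<close> by blast
      from cSup_upper[OF this bdd(2)] show False using \<open>0 < e\<close> by simp
    qed
  qed
  have memS: "Inf S' \<in> S" "Sup S' \<in> S" using mem notV by (auto simp: S_def S'_def m)
  have "S \<subseteq> S'" by (auto simp: S_def S'_def)
  then have "Inf S = Inf S'" "Sup S = Sup S'"
    using memS bdd by (auto intro!: cInf_eq_minimum cSup_eq_maximum intro: cInf_lower cSup_upper)
  with memS show ?thesis by blast
qed

end

section \<open>One-sided derivatives and chords of convex functions\<close>

text \<open>A convex function that exceeds \<open>m\<close> everywhere to the right of \<open>b\<close>, but not at some point to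
  the left of \<open>b\<close>, has a nonnegative right derivative at \<open>b\<close>. A majorant \<open>U\<close> grows at least
  linearly far to the right of \<open>b\<close>; the assumption on \<open>U\<close> near \<open>b\<close> is needed to keep the slopes of
  its chords from \<open>(b, l)\<close> away from \<open>0\<close> there.\<close>

lemma convex_right_end:
  fixes C U :: "real \<Rightarrow> real"
  assumes cv: "convex_on UNIV C" and CU: "\<And>t. C t \<le> U t"
    and a: "C a \<le> m" "a < b" and right: "\<And>t. b < t \<Longrightarrow> m < C t"
    and l: "l \<le> C b" "l \<le> m"
    and e: "0 < e" and near: "\<And>t. b < t \<Longrightarrow> t \<le> b + 1 \<Longrightarrow> l + e \<le> U t"
  shows "\<exists>d>0. \<forall>t>b. d \<le> (U t - l) / (t - b)"
    and "\<exists>D\<ge>0. (C has_real_derivative D) (at_right b) \<and> (\<forall>t>b. D \<le> (U t - l) / (t - b))"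
proof -
  have chord: "C s - m \<le> (s - a) / (t - a) * (C t - m)"
    if "a < s" "s \<le> t" for s t
  proof -
    define r where "r = (s - a) / (t - a)"
    have r: "0 \<le> r" "r \<le> 1" using that by (auto simp: r_def)
    have "(1 - r) * a + r * t = a + r * (t - a)" by (simp add: algebra_simps)
    also have "\<dots> = s" using that by (simp add: r_def)
    finally have s: "(1 - r) * a + r * t = s" .
    have "C s \<le> (1 - r) * C a + r * C t"
      using convex_onD[OF cv r, of a t] s by simp
    also have "\<dots> \<le> (1 - r) * m + r * C t"
      using a(1) r by (intro add_right_mono mult_left_mono) auto
    finally show ?thesis by (simp add: r_def[symmetric] algebra_simps)
  qed
  \<comment> \<open>The gap \<open>e\<close> serves for \<open>t \<le> b + 1\<close>, the slope from \<open>(a, m)\<close> to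
    \<open>(b + 1, C (b + 1))\<close> beyond.\<close>
  show "\<exists>d>0. \<forall>t>b. d \<le> (U t - l) / (t - b)"
  proof (intro exI[of _ "min e ((C (b + 1) - m) / (b + 1 - a))"] conjI allI impI)
    show "0 < min e ((C (b + 1) - m) / (b + 1 - a))"
      using e a right[of "b + 1"] by simp
    fix t assume t: "b < t"
    show "min e ((C (b + 1) - m) / (b + 1 - a)) \<le> (U t - l) / (t - b)"
    proof (cases "t \<le> b + 1")
      case True
      have "e \<le> (U t - l) / 1" using near[OF t True] by simp
      also have "\<dots> \<le> (U t - l) / (t - b)"
        using near[OF t True] e t True by (intro divide_left_mono) auto
      finally show ?thesis by simp
    next
      case False
      let ?q = "(C (b + 1) - m) / (b + 1 - a)"
      have "C (b + 1) - m \<le> (b + 1 - a) / (t - a) * (C t - m)"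
        using chord[of "b + 1" t] a False by simp
      then have "?q * (t - a) \<le> C t - m"
        using a False by (simp add: field_simps)
      moreover have "?q * (t - b) \<le> ?q * (t - a)"
        using a right[of "b + 1"] by (intro mult_left_mono) auto
      ultimately have "?q * (t - b) \<le> U t - l" using CU[of t] l by linarith
      then have "?q \<le> (U t - l) / (t - b)" using t by (simp add: le_divide_eq)
      then show ?thesis by simp
    qed
  qed
  define q where "q t = (C t - C b) / (t - b)" for t
  have qmono: "q s \<le> q t" if "b < s" "s \<le> t" for s t
  proof (cases "s = t")
    case False
    have "(C b - C s) / (b - s) \<le> (C b - C t) / (b - t)"
      using that False by (intro convex_on_slope_le(1)[OF cv]) auto
    then show ?thesis using that unfolding q_def by (metis minus_diff_eq minus_divide_divide)
  qed simp
  have q0: "0 \<le> q t" if "b < t" for t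
  proof -
    have "(b - a) / (t - a) * (C t - m) \<le> 1 * (C t - m)"
      using that a right[OF that] by (intro mult_right_mono) auto
    then have "C b \<le> C t" using chord[of b t] that a by simp
    then show ?thesis using that by (simp add: q_def)
  qed
  define D where "D = Inf (q ` ({b<..} \<inter> UNIV))"
  have "(q \<longlongrightarrow> D) (at b within ({b<..} \<inter> UNIV))"
    unfolding D_def using qmono q0 by (intro Lim_right_bound[where K = 0]) auto
  then have "(C has_real_derivative D) (at_right b)"
    unfolding has_field_derivative_iff q_def by simp
  moreover have "0 \<le> D" unfolding D_def using q0 gt_ex[of b] by (intro cINF_greatest) auto
  moreover have "D \<le> (U t - l) / (t - b)" if "b < t" for t
  proof -
    have "bdd_below (q ` {b<..})" using q0 by (intro bdd_belowI[of _ 0]) auto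
    then have "D \<le> q t" unfolding D_def using that by (intro cINF_lower) auto
    also have "\<dots> \<le> (U t - l) / (t - b)"
      unfolding q_def using that CU[of t] l by (intro divide_right_mono) auto
    finally show ?thesis .
  qed
  ultimately show "\<exists>D\<ge>0. (C has_real_derivative D) (at_right b) \<and> (\<forall>t>b. D \<le> (U t - l) / (t - b))"
    by blast
qed

lemma convex_left_end:
  fixes C U :: "real \<Rightarrow> real"
  assumes cv: "convex_on UNIV C" and CU: "\<And>t. C t \<le> U t"
    and a: "C a \<le> m" "b < a" and left: "\<And>t. t < b \<Longrightarrow> m < C t"
    and l: "l \<le> C b" "l \<le> m"
    and e: "0 < e" and near: "\<And>t. t < b \<Longrightarrow> b - 1 \<le> t \<Longrightarrow> l + e \<le> U t"
  shows "\<exists>d>0. \<forall>t<b. d \<le> (U t - l) / (b - t)"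
    and "\<exists>D\<ge>0. (C has_real_derivative - D) (at_left b) \<and> (\<forall>t<b. D \<le> (U t - l) / (b - t))"
proof -
  let ?C = "\<lambda>t. C (- t)" and ?U = "\<lambda>t. U (- t)"
  have cv': "convex_on UNIV ?C"
  proof (rule convex_onI)
    fix t x y :: real assume "0 < t" "t < 1"
    then show "C (- ((1 - t) *\<^sub>R x + t *\<^sub>R y)) \<le> (1 - t) * C (- x) + t * C (- y)"
      using convex_onD[OF cv, of t "- x" "- y"] by (simp add: algebra_simps)
  qed simp
  have all: "(\<forall>t>-b. P (- t) (t - - b)) \<longleftrightarrow> (\<forall>t<b. P t (b - t))" for P :: "real \<Rightarrow> real \<Rightarrow> bool"
  proof (intro iffI allI impI)
    fix t assume *: "\<forall>t>-b. P (- t) (t - - b)" "t < b"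
    from *(1)[rule_format, of "- t"] *(2) show "P t (b - t)" by simp
  next
    fix t assume *: "\<forall>t<b. P t (b - t)" "- b < t"
    from *(1)[rule_format, of "- t"] *(2) show "P (- t) (t - - b)" by (simp add: add.commute)
  qed
  note ends = convex_right_end[OF cv' CU, where a = "- a" and b = "- b" and m = m and l = l and e = e]
  have "\<exists>d>0. \<forall>t>-b. d \<le> (U (- t) - l) / (t - - b)"
    by (rule ends) (use assms in auto)
  then show "\<exists>d>0. \<forall>t<b. d \<le> (U t - l) / (b - t)"
    using all[of "\<lambda>t x. _ \<le> (U t - l) / x"] by simp
  have "\<exists>D\<ge>0. (?C has_real_derivative D) (at_right (- b)) \<and> (\<forall>t>-b. D \<le> (U (- t) - l) / (t - - b))"
    by (rule ends) (use assms in auto)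
  then obtain D where D: "0 \<le> D" "(?C has_real_derivative D) (at_right (- b))"
      "\<forall>t<b. D \<le> (U t - l) / (b - t)"
    using all[of "\<lambda>t x. _ \<le> (U t - l) / x"] by auto
  have "(?C \<circ> uminus has_real_derivative D * - 1) (at_left b)"
    using D(2) by (intro DERIV_image_chain) (auto intro!: derivative_eq_intros simp: image_uminus_lessThan)
  with D show "\<exists>D\<ge>0. (C has_real_derivative - D) (at_left b) \<and> (\<forall>t<b. D \<le> (U t - l) / (b - t))"
    by (auto simp: o_def)
qed

section \<open>Minimum and one-sided derivatives of the average cost\<close>

context periodic_transport
begin

lemma lower_cost_le_avg_cost: "ereal (lower_cost c \<theta>) \<le> avg_cost c F0 F1 \<theta>"
proof (rule avg_cost_lower_bound)
  fix v :: real assume "v \<in> {0..1}"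
  then obtain u1 u2 where "u1 \<in> {-1..2}" "u2 \<in> {\<theta> - 1..\<theta> + 2}" "h v (v + \<theta>) = c u1 u2"
    using transported_cost_window by blast
  then show "lower_cost c \<theta> \<le> h v (v + \<theta>)" using lower_cost_le by simp
qed

lemma avg_cost_le_upper_cost: "avg_cost c F0 F1 \<theta> \<le> upper_cost c \<theta>"
proof (cases "upper_cost c \<theta>")
  case (real M)
  then have "\<forall>u1\<in>{-1..2}. \<forall>u2\<in>{\<theta> - 1..\<theta> + 2}. c u1 u2 \<le> M"
    using upper_cost_le_real_iff[of \<theta> M] by simp
  then have "h v (v + \<theta>) \<le> M" if "v \<in> {0..1}" for v
    using transported_cost_window[OF that, of \<theta>] by auto
  then have "avg_cost c F0 F1 \<theta> \<le> ereal M" by (rule avg_cost_upper_bound)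
  with real show ?thesis by simp
next
  case MInf
  with lower_cost_le_upper_cost[of \<theta> \<theta>] show ?thesis by simp
qed simp

lemma minimum_and_slopes:
  fixes C S lo hi
  defines "C \<equiv> avg_cost c F0 F1"
    and "S \<equiv> {\<theta>. ereal (lower_cost c \<theta>) \<le> min_upper_cost c}"
    and "lo \<equiv> Inf S" and "hi \<equiv> Sup S"
  assumes fin: "min_upper_cost c < \<infinity>"
  shows "lo < hi"
    and "0 < left_slope_bound c lo" "left_slope_bound c lo < \<infinity>"
    and "0 < right_slope_bound c hi" "right_slope_bound c hi < \<infinity>"
    and "\<bar>C \<theta>\<bar> \<noteq> \<infinity>"
    and "\<exists>\<theta>\<in>{lo..hi}. \<forall>\<theta>'. C \<theta> \<le> C \<theta>'"
    and "\<exists>dl. ((\<lambda>\<theta>. real_of_ereal (C \<theta>)) has_real_derivative dl) (at_left lo) \<and>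
           - left_slope_bound c lo \<le> ereal dl \<and> dl \<le> 0"
    and "\<exists>dr. ((\<lambda>\<theta>. real_of_ereal (C \<theta>)) has_real_derivative dr) (at_right hi) \<and>
           0 \<le> dr \<and> ereal dr \<le> right_slope_bound c hi"
proof -
  obtain m a where m: "min_upper_cost c = ereal m" "upper_cost c a = ereal m"
    using min_upper_cost_finiteE fin by blast
  have bdd: "bdd_below S" "bdd_above S" and mem: "lo \<in> S" "hi \<in> S"
    and a: "lo < a" "a < hi"
    using sublevel_bdd_below sublevel_bdd_above Inf_sublevel_in Sup_sublevel_in
      sublevel_spread[of a] fin m unfolding S_def lo_def hi_def by auto
  then show "lo < hi" by simp
  define L where "L = lower_cost c"
  define U where "U \<theta> = real_of_ereal (upper_cost c \<theta>)" for \<theta>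
  define Cr where "Cr \<theta> = real_of_ereal (C \<theta>)" for \<theta>
  have U: "upper_cost c \<theta> = ereal (U \<theta>)" for \<theta>
    using upper_cost_finite[of a \<theta>] lower_cost_le_upper_cost[of \<theta> \<theta>] m(2)
    by (cases "upper_cost c \<theta>") (auto simp: U_def)
  have LC: "ereal (L \<theta>) \<le> C \<theta>" and CU: "C \<theta> \<le> ereal (U \<theta>)" for \<theta>
    using lower_cost_le_avg_cost[of \<theta>] avg_cost_le_upper_cost[of \<theta>] unfolding C_def L_def U by auto
  show finC: "\<bar>C \<theta>\<bar> \<noteq> \<infinity>" for \<theta>
    using LC[of \<theta>] CU[of \<theta>] by (cases "C \<theta>") auto
  then have C: "C \<theta> = ereal (Cr \<theta>)" for \<theta> by (simp add: Cr_def ereal_real')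
  have LCr: "L \<theta> \<le> Cr \<theta>" and CrU: "Cr \<theta> \<le> U \<theta>" for \<theta>
    using LC[of \<theta>] CU[of \<theta>] by (simp_all add: C)
  have cv: "convex_on UNIV Cr"
  proof (rule convex_onI)
    fix t x y :: real assume t: "0 < t" "t < 1"
    have "C ((1 - t) * x + t * y) \<le> ereal (1 - t) * C x + ereal t * C y"
      using avg_cost_ext_convex t unfolding ext_convex_def C_def by simp
    then show "Cr ((1 - t) *\<^sub>R x + t *\<^sub>R y) \<le> (1 - t) * Cr x + t * Cr y" by (simp add: C)
  qed simp
  have Ca: "Cr a \<le> m" using CrU[of a] U[of a] m(2) by simp
  have Lm: "L lo \<le> m" "L hi \<le> m" using mem m(1) by (simp_all add: S_def L_def)
  have "m < L \<theta>" if "\<theta> < lo \<or> hi < \<theta>" for \<theta>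
  proof (rule ccontr)
    assume "\<not> m < L \<theta>"
    then have "\<theta> \<in> S" by (simp add: S_def L_def m(1))
    with that show False
      using cInf_lower[OF _ bdd(1)] cSup_upper[OF _ bdd(2)] unfolding lo_def hi_def by (meson not_le)
  qed
  then have out: "m < Cr \<theta>" if "\<theta> < lo \<or> hi < \<theta>" for \<theta>
    using that LCr[of \<theta>] by (meson less_le_trans)
  obtain e1 where e1: "0 < e1" "\<And>\<theta>. \<bar>\<theta> - lo\<bar> \<le> 1 \<Longrightarrow> L lo + e1 \<le> U \<theta>"
    using lower_upper_gap[of lo] unfolding U L_def by auto
  obtain e2 where e2: "0 < e2" "\<And>\<theta>. \<bar>\<theta> - hi\<bar> \<le> 1 \<Longrightarrow> L hi + e2 \<le> U \<theta>"
    using lower_upper_gap[of hi] unfolding U L_def by auto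
  have left: "left_slope_bound c lo = (INF \<theta>\<in>{..<lo}. ereal ((U \<theta> - L lo) / (lo - \<theta>)))"
    unfolding left_slope_bound_def U L_def by (intro INF_cong) auto
  have right: "right_slope_bound c hi = (INF \<theta>\<in>{hi<..}. ereal ((U \<theta> - L hi) / (\<theta> - hi)))"
    unfolding right_slope_bound_def U L_def by (intro INF_cong) auto
  show "left_slope_bound c lo < \<infinity>"
    unfolding left by (rule le_less_trans[OF INF_lower[of "lo - 1"]]) auto
  show "right_slope_bound c hi < \<infinity>"
    unfolding right by (rule le_less_trans[OF INF_lower[of "hi + 1"]]) auto
  obtain d where d: "0 < d" "\<And>\<theta>. \<theta> < lo \<Longrightarrow> d \<le> (U \<theta> - L lo) / (lo - \<theta>)"
    using convex_left_end(1)[OF cv CrU Ca a(1) _ LCr Lm(1) e1(1)] out e1(2) by auto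
  then have "ereal d \<le> left_slope_bound c lo" unfolding left by (auto intro: INF_greatest)
  then show "0 < left_slope_bound c lo" using d(1) by (auto intro: less_le_trans[of _ "ereal d"])
  obtain d where d: "0 < d" "\<And>\<theta>. hi < \<theta> \<Longrightarrow> d \<le> (U \<theta> - L hi) / (\<theta> - hi)"
    using convex_right_end(1)[OF cv CrU Ca a(2) _ LCr Lm(2) e2(1)] out e2(2) by auto
  then have "ereal d \<le> right_slope_bound c hi" unfolding right by (auto intro: INF_greatest)
  then show "0 < right_slope_bound c hi" using d(1) by (auto intro: less_le_trans[of _ "ereal d"])
  obtain D where D: "0 \<le> D" "(Cr has_real_derivative - D) (at_left lo)"
      "\<And>\<theta>. \<theta> < lo \<Longrightarrow> D \<le> (U \<theta> - L lo) / (lo - \<theta>)"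
    using convex_left_end(2)[OF cv CrU Ca a(1) _ LCr Lm(1) e1(1)] out e1(2) by auto
  then have "ereal D \<le> left_slope_bound c lo" unfolding left by (auto intro: INF_greatest)
  then have "- left_slope_bound c lo \<le> ereal (- D)"
    by (metis ereal_minus_le_minus uminus_ereal.simps(1))
  with D show "\<exists>dl. ((\<lambda>\<theta>. real_of_ereal (C \<theta>)) has_real_derivative dl) (at_left lo) \<and>
      - left_slope_bound c lo \<le> ereal dl \<and> dl \<le> 0"
    unfolding Cr_def[symmetric] by (intro exI[of _ "- D"]) auto
  obtain D where D: "0 \<le> D" "(Cr has_real_derivative D) (at_right hi)"
      "\<And>\<theta>. hi < \<theta> \<Longrightarrow> D \<le> (U \<theta> - L hi) / (\<theta> - hi)"
    using convex_right_end(2)[OF cv CrU Ca a(2) _ LCr Lm(2) e2(1)] out e2(2) by auto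
  then have "ereal D \<le> right_slope_bound c hi" unfolding right by (auto intro: INF_greatest)
  with D show "\<exists>dr. ((\<lambda>\<theta>. real_of_ereal (C \<theta>)) has_real_derivative dr) (at_right hi) \<and>
      0 \<le> dr \<and> ereal dr \<le> right_slope_bound c hi"
    unfolding Cr_def[symmetric] by blast
  have "\<exists>\<theta>0\<in>{lo..hi}. \<forall>\<theta>\<in>{lo..hi}. C \<theta>0 \<le> C \<theta>"
    using a avg_cost_lsc unfolding C_def by (intro lsc_attains_inf compact_Icc) auto
  then obtain \<theta>0 where \<theta>0: "\<theta>0 \<in> {lo..hi}" "\<And>\<theta>. \<theta> \<in> {lo..hi} \<Longrightarrow> C \<theta>0 \<le> C \<theta>" by blast
  have "C \<theta>0 \<le> C \<theta>" for \<theta>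
  proof (cases "\<theta> \<in> {lo..hi}")
    case False
    then have "Cr a \<le> Cr \<theta>" using out[of \<theta>] Ca by fastforce
    moreover have "C \<theta>0 \<le> C a" using \<theta>0(2) a by simp
    ultimately show ?thesis by (simp add: C)
  qed (rule \<theta>0)
  with \<theta>0(1) show "\<exists>\<theta>\<in>{lo..hi}. \<forall>\<theta>'. C \<theta> \<le> C \<theta>'" by blast
qed

end

theorem lemma18:
  fixes c :: "real \<Rightarrow> real \<Rightarrow> real" and \<mu>0 \<mu>1 :: "real measure"
    and C :: "real \<Rightarrow> ereal"
  assumes "lower_semicontinuous (\<lambda>(x, y). c x y)"
    and "\<exists>m. \<forall>x y. m \<le> c x y"
    and "monge c"
    and "integer_shift_invariant c"
    and "growth_condition c"
    and "periodic_measure \<mu>0" and "unit_mass_per_period \<mu>0"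
    and "periodic_measure \<mu>1" and "unit_mass_per_period \<mu>1"
  defines "C \<equiv> avg_cost c (distr_fun \<mu>0) (distr_fun \<mu>1)"
  shows "ext_convex C \<and>
    (\<forall>\<theta>. (INF (x, y). c x y) \<le> lower_cost c \<theta> \<and>
         ereal (lower_cost c \<theta>) \<le> C \<theta> \<and> C \<theta> \<le> upper_cost c \<theta>) \<and>
    (\<forall>S \<Theta>lo \<Theta>hi.
       continuous_on UNIV (\<lambda>(x, y). c x y) \<and>
         S = {\<theta>. ereal (lower_cost c \<theta>) = min_upper_cost c} \<or>
       min_upper_cost c < \<infinity> \<and>
         S = {\<theta>. ereal (lower_cost c \<theta>) \<le> min_upper_cost c} \<longrightarrow>
       \<Theta>lo = Inf S \<longrightarrow> \<Theta>hi = Sup S \<longrightarrow>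
       (\<exists>\<theta>. upper_cost c \<theta> = min_upper_cost c) \<and>
       S \<noteq> {} \<and> bdd_below S \<and> bdd_above S \<and>
       \<Theta>lo < \<Theta>hi \<and>
       0 < left_slope_bound c \<Theta>lo \<and> left_slope_bound c \<Theta>lo < \<infinity> \<and>
       0 < right_slope_bound c \<Theta>hi \<and> right_slope_bound c \<Theta>hi < \<infinity> \<and>
       (\<forall>\<theta>. \<bar>C \<theta>\<bar> \<noteq> \<infinity>) \<and>
       (\<exists>\<theta>\<in>{\<Theta>lo..\<Theta>hi}. \<forall>\<theta>'. C \<theta> \<le> C \<theta>') \<and>
       (\<exists>dl dr.
          ((\<lambda>\<theta>. real_of_ereal (C \<theta>)) has_real_derivative dl) (at_left \<Theta>lo) \<and>
          ((\<lambda>\<theta>. real_of_ereal (C \<theta>)) has_real_derivative dr) (at_right \<Theta>hi) \<and>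
          - left_slope_bound c \<Theta>lo \<le> ereal dl \<and> dl \<le> 0 \<and>
          0 \<le> dr \<and> ereal dr \<le> right_slope_bound c \<Theta>hi))"
proof -
  have \<mu>: "sets \<mu>0 = sets borel" "sets \<mu>1 = sets borel"
    using assms by (auto simp: periodic_measure_def)
  interpret periodic_transport c "distr_fun \<mu>0" "distr_fun \<mu>1"
  proof unfold_locales
    show "distr_fun \<mu>0 (x + 1) = distr_fun \<mu>0 x + 1" "distr_fun \<mu>1 (x + 1) = distr_fun \<mu>1 x + 1" for x
      by (intro distr_fun_shift assms \<mu>)+
    show "mono (distr_fun \<mu>0)" "mono (distr_fun \<mu>1)"
      by (intro distr_fun_mono assms \<mu>)+
    show "distr_fun \<mu>0 0 = 0" "distr_fun \<mu>1 0 = 0" by (simp_all add: distr_fun_def)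
  qed (fact assms)+
  let ?S = "{\<theta>. ereal (lower_cost c \<theta>) \<le> min_upper_cost c}"
  show ?thesis
  proof (intro conjI allI impI)
    show "ext_convex C" unfolding C_def by (rule avg_cost_ext_convex)
    fix \<theta>
    show "(INF (x, y). c x y) \<le> lower_cost c \<theta>"
      unfolding lower_cost_def
    proof (rule cINF_superset_mono)
      obtain k where "\<And>x y. - k \<le> c x y" using ex_lower_bound by blast
      then show "bdd_below ((\<lambda>(x, y). c x y) ` UNIV)" by (intro bdd_belowI[of _ "- k"]) auto
    qed auto
    show "ereal (lower_cost c \<theta>) \<le> C \<theta>" "C \<theta> \<le> upper_cost c \<theta>"
      unfolding C_def by (rule lower_cost_le_avg_cost avg_cost_le_upper_cost)+
  next
    show "\<exists>\<theta>. upper_cost c \<theta> = min_upper_cost c" by (rule min_upper_cost_attained)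
  next
    fix S \<Theta>lo \<Theta>hi
    assume S: "continuous_on UNIV (\<lambda>(x, y). c x y) \<and>
         S = {\<theta>. ereal (lower_cost c \<theta>) = min_upper_cost c} \<or>
       min_upper_cost c < \<infinity> \<and>
         S = {\<theta>. ereal (lower_cost c \<theta>) \<le> min_upper_cost c}"
      and lohi: "\<Theta>lo = Inf S" "\<Theta>hi = Sup S"
    have fin: "min_upper_cost c < \<infinity>" 
      using S by (elim disjE conjE) (rule continuous_min_upper_cost_finite)
    have sub: "S \<subseteq> ?S" using S by auto
    have ends: "S \<noteq> {} \<and> Inf S = Inf ?S \<and> Sup S = Sup ?S"
      using S
    proof (elim disjE conjE)
      assume "continuous_on UNIV (\<lambda>(x, y). c x y)"
        and "S = {\<theta>. ereal (lower_cost c \<theta>) = min_upper_cost c}"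
      then show ?thesis using level_endpoints by simp
    next
      assume "S = ?S"
      then show ?thesis using Inf_sublevel_in[OF fin] by auto
    qed
    then show "S \<noteq> {}" by simp
    show "bdd_below S" "bdd_above S"
      by (rule bdd_below_mono[OF sublevel_bdd_below[OF fin] sub]
          bdd_above_mono[OF sublevel_bdd_above[OF fin] sub])+
    have \<Theta>: "\<Theta>lo = Inf ?S" "\<Theta>hi = Sup ?S" using lohi ends by auto
    note facts = minimum_and_slopes[OF fin, folded C_def \<Theta>]
    show "\<Theta>lo < \<Theta>hi" "0 < left_slope_bound c \<Theta>lo" "left_slope_bound c \<Theta>lo < \<infinity>"
      "0 < right_slope_bound c \<Theta>hi" "right_slope_bound c \<Theta>hi < \<infinity>"
      "\<exists>\<theta>\<in>{\<Theta>lo..\<Theta>hi}. \<forall>\<theta>'. C \<theta> \<le> C \<theta>'"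
      by (rule facts)+
    show "\<bar>C \<theta>\<bar> \<noteq> \<infinity>" for \<theta> by (rule facts)
    show "\<exists>dl dr.
          ((\<lambda>\<theta>. real_of_ereal (C \<theta>)) has_real_derivative dl) (at_left \<Theta>lo) \<and>
          ((\<lambda>\<theta>. real_of_ereal (C \<theta>)) has_real_derivative dr) (at_right \<Theta>hi) \<and>
          - left_slope_bound c \<Theta>lo \<le> ereal dl \<and> dl \<le> 0 \<and>
          0 \<le> dr \<and> ereal dr \<le> right_slope_bound c \<Theta>hi"
    proof -
      obtain dl dr where
        "((\<lambda>\<theta>. real_of_ereal (C \<theta>)) has_real_derivative dl) (at_left \<Theta>lo) \<and>
          - left_slope_bound c \<Theta>lo \<le> ereal dl \<and> dl \<le> 0"
        "((\<lambda>\<theta>. real_of_ereal (C \<theta>)) has_real_derivative dr) (at_right \<Theta>hi) \<and>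
          0 \<le> dr \<and> ereal dr \<le> right_slope_bound c \<Theta>hi"
        using facts(8,9) by (elim exE)
      then show ?thesis by (intro exI[of _ dl] exI[of _ dr]) simp
    qed
  qed
qed

end
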